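(* Let $W$ be a real-valued random variable with finite second moment. The following are equivalent: (1) $W$ has the standard normal distribution (mean zero, variance one). (2) For all absolutely continuous functions $f:\mathbb{R}\to\mathbb{R}$ with bounded derivative, $\mathbb{E} f'(W)=\mathbb{E}\, W f(W)$. (3) $\mathbb{E} W^2=1$ and $W \stackrel{d}{=} V W^{(2)}$, where $V$ is uniformly distributed on $(-1,1)$, $W^{(2)}$ has the $2$-power bias distribution of $W$, and $V$ is independent of $W^{(2)}$.
   Context: $\stackrel{d}{=}$ denotes equality in distribution. For $\alpha>0$ and a real random variable $X$ with distribution function $F$ and $0<\mathbb{E}|X|^\alpha<\infty$, the $\alpha$-power bias distribution $F^{(\alpha)}$ of $X$ is defined by $dF^{(\alpha)}(x)=|x|^\alpha dF(x)/\mathbb{E}|X|^\alpha$, and $X^{(\alpha)}$ denotes a random variable with this distribution; equivalently $\mathbb{E} f(X^{(\alpha)})=\mathbb{E}[|X|^\alpha f(X)]/\mathbb{E}|X|^\alpha$ for every measurable $f$ with $\mathbb{E}|X|^\alpha|f(X)|<\infty$. A function $f:\mathbb{R}\to\mathbb{R}$ is absolutely continuous if it is absolutely continuous on every compact interval; it is then differentiable almost everywhere, $f'$ denotes its derivative where it exists and is set to $0$ elsewhere, and "bounded derivative" means that $f'$ is bounded. *)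

theory Defs
  imports "HOL-Probability.Probability"
begin

definition abs_continuous_on_interval :: "(real \<Rightarrow> real) \<Rightarrow> real \<Rightarrow> real \<Rightarrow> bool" where
  "abs_continuous_on_interval f a b \<longleftrightarrow>
    (\<forall>\<epsilon>>0. \<exists>\<delta>>0. \<forall>(n::nat) (u::nat \<Rightarrow> real) (v::nat \<Rightarrow> real).
      (\<forall>i<n. a \<le> u i \<and> u i < v i \<and> v i \<le> b) \<longrightarrow>
      disjoint_family_on (\<lambda>i. {u i<..<v i}) {..<n} \<longrightarrow>
      (\<Sum>i<n. v i - u i) < \<delta> \<longrightarrow>
      (\<Sum>i<n. \<bar>f (v i) - f (u i)\<bar>) < \<epsilon>)"

(* Global absolute continuity is understood locally, i.e. with delta depending on the interval. *)
definition abs_continuous :: "(real \<Rightarrow> real) \<Rightarrow> bool" where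
  "abs_continuous f \<longleftrightarrow> (\<forall>a b. a \<le> b \<longrightarrow> abs_continuous_on_interval f a b)"

(* The library's deriv is unspecified at points of non-differentiability; here it is 0 there. *)
definition deriv0 :: "(real \<Rightarrow> real) \<Rightarrow> real \<Rightarrow> real" where
  "deriv0 f x = (if f differentiable (at x) then deriv f x else 0)"

(* The alpha-power bias of a probability law \<mu> on the reals. It is meaningful only if alpha > 0 and
   |x|^alpha is \<mu>-integrable with nonzero integral. The powr used here has 0 powr \<alpha> = 0. *)
definition power_bias :: "real \<Rightarrow> real measure \<Rightarrow> real measure" where
  "power_bias \<alpha> \<mu> =
    density \<mu> (\<lambda>x. ennreal (\<bar>x\<bar> powr \<alpha> / (\<integral>y. \<bar>y\<bar> powr \<alpha> \<partial>\<mu>)))"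

end

theory Submission
  imports Defs
begin

text \<open>
  All three statements concern only the law \<open>\<mu>\<close> of \<open>W\<close>, and each of the last two is compared with the first.

  From Stein's equation to normality only the test functions \<open>x \<mapsto> sin (t * x)\<close> and
  \<open>x \<mapsto> cos (t * x)\<close> are needed. For them the equation says that the characteristic function
  \<open>\<phi>\<close> of \<open>\<mu>\<close> solves \<open>\<phi>' t = - t * \<phi> t\<close>; as \<open>\<phi> 0 = 1\<close>, it is
  \<open>exp (- t\<^sup>2 / 2)\<close>, and Levy's uniqueness theorem identifies \<open>\<mu>\<close>
  (\<open>std_normal_if_trig_stein\<close>).

  The bias statement is the same differential equation in disguise. Let \<open>V\<close> be uniform on
  \<open>(-1, 1)\<close> and independent of a variable \<open>W2\<close> with the square bias law of \<open>\<mu>\<close>, and let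
  \<open>E h\<close> be the integral of \<open>h\<close> under \<open>\<mu>\<close>. Averaging over \<open>V\<close> first turns \<open>cos (t * V * w)\<close> into
  \<open>sin (t * w) / (t * w)\<close> and \<open>sin (t * V * w)\<close> into zero, and the factor \<open>w\<^sup>2\<close> of the bias then gives
  \<open>E[w * sin (t * w)] / t\<close> for the cosine transform of the law of \<open>V * W2\<close>
  (\<open>uniform_times_bias_trig\<close>). So \<open>V * W2\<close> has law \<open>\<mu>\<close> exactly if \<open>\<phi>\<close> is real and
  \<open>\<phi>' t = - t * \<phi> t\<close>.

  From normality to Stein's equation one integrates by parts against the Gaussian density \<open>p\<close>, using
  \<open>p' x = - x * p x\<close>. The difficulty lies in the class of test functions. A bound on \<open>deriv0 f\<close>
  says nothing at points where \<open>f\<close> has no derivative, so it is essential that an absolutely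
  continuous function is differentiable almost everywhere. This rests on Lebesgue's theorem on monotone functions
  (\<open>mono_differentiable_ae\<close>, by Vitali's covering theorem) and on the Jordan decomposition of a
  function of bounded variation. The fundamental theorem of calculus for absolutely continuous
  functions (\<open>abs_continuous_FTC\<close>) then shows that \<open>f\<close> is Lipschitz, which makes all integrals
  converge, and applies to \<open>p * f\<close> itself. Finally, the law of \<open>W\<close> is a measure on Borel sets, so
  \<open>deriv0 f\<close> must be Borel measurable and not merely Lebesgue measurable
  (\<open>borel_measurable_deriv0\<close>).
\<close>

section \<open>Vitali coverings by intervals\<close>

text \<open>
  The intervals need not be centred at \<open>x\<close>, and \<open>x\<close> may be an end point. With one-sided intervals
  allowed, a bound on the slopes over all small intervals around \<open>x\<close> is a bound on the difference quotients at \<open>x\<close>.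
\<close>

definition has_small_intervals :: "(real \<Rightarrow> real \<Rightarrow> bool) \<Rightarrow> real \<Rightarrow> bool" where
  "has_small_intervals P x \<longleftrightarrow>
    (\<forall>d>0. \<exists>u v. u < v \<and> u \<le> x \<and> x \<le> v \<and> v - u < d \<and> P u v)"

lemma not_has_small_intervalsE:
  assumes "\<not> has_small_intervals P x"
  obtains d where "d > 0" "\<And>u v. \<lbrakk>u < v; u \<le> x; x \<le> v; v - u < d\<rbrakk> \<Longrightarrow> \<not> P u v"
  using assms unfolding has_small_intervals_def by blast

lemma Vitali_interval_cover:
  fixes S U :: "real set"
  assumes U: "open U" "S \<subseteq> U"
    and small: "\<And>x. x \<in> S \<Longrightarrow> has_small_intervals P x"
  obtains C where "countable C" "\<And>u v. (u, v) \<in> C \<Longrightarrow> u < v \<and> {u..v} \<subseteq> U \<and> P u v"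
    "disjoint_family_on (\<lambda>(u, v). {u..v}) C" "negligible (S - (\<Union>(u, v)\<in>C. {u..v}))"
proof -
  define K where "K = {(u, v). u < v \<and> {u..v} \<subseteq> U \<and> P u v}"
  define c where "c = (\<lambda>(u, v). (u + v) / 2 :: real)"
  define r where "r = (\<lambda>(u, v). (v - u) / 2 :: real)"
  have ball: "cball (c (u, v)) (r (u, v)) = {u..v}" for u v
    by (simp add: c_def r_def cball_eq_atLeastAtMost field_simps)
  have "\<exists>i. i \<in> K \<and> x \<in> cball (c i) (r i) \<and> r i < d" if x: "x \<in> S" and d: "0 < d" for x d
  proof -
    obtain e where e: "e > 0" "ball x e \<subseteq> U" using U x openE by blast
    obtain u v where uv: "u < v" "u \<le> x" "x \<le> v" "v - u < min d e" "P u v"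
      using small[OF x, unfolded has_small_intervals_def, rule_format, of "min d e"] d e by auto
    have "{u..v} \<subseteq> ball x e" using uv by (auto simp: dist_real_def)
    with uv e have "(u, v) \<in> K" by (auto simp: K_def)
    moreover have "x \<in> cball (c (u, v)) (r (u, v))" unfolding ball using uv by auto
    moreover have "r (u, v) < d" using uv by (simp add: r_def)
    ultimately show ?thesis by blast
  qed
  note small' = this
  have rpos: "0 < r i" if "i \<in> K" for i using that by (auto simp: K_def r_def)
  obtain C where C: "countable C" "C \<subseteq> K"
     "pairwise (\<lambda>i j. disjnt (cball (c i) (r i)) (cball (c j) (r j))) C"
     "negligible (S - (\<Union>i \<in> C. cball (c i) (r i)))"
    by (rule Vitali_covering_theorem_cballs[of K r S c, OF rpos small'])
  have eq: "(\<lambda>i. cball (c i) (r i)) = (\<lambda>(u, v). {u..v})"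
    using ball by (auto simp: fun_eq_iff)
  show ?thesis
  proof
    show "countable C" by fact
    show "\<And>u v. (u, v) \<in> C \<Longrightarrow> u < v \<and> {u..v} \<subseteq> U \<and> P u v" using C(2) by (auto simp: K_def)
    show "disjoint_family_on (\<lambda>(u, v). {u..v}) C"
      using C(3) unfolding eq[symmetric] by (auto simp: disjoint_family_on_def pairwise_def disjnt_def)
    show "negligible (S - (\<Union>(u, v)\<in>C. {u..v}))" using C(4) unfolding eq .
  qed
qed

text \<open>
  Only the interiors have to be disjoint, as in the definition of absolute continuity; neighbouring
  intervals may share an end point.
\<close>

definition disjoint_subintervals ::
    "real \<Rightarrow> real \<Rightarrow> 'i set \<Rightarrow> ('i \<Rightarrow> real) \<Rightarrow> ('i \<Rightarrow> real) \<Rightarrow> bool" where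
  "disjoint_subintervals a b I u v \<longleftrightarrow> finite I \<and> (\<forall>i\<in>I. a \<le> u i \<and> u i < v i \<and> v i \<le> b) \<and>
    disjoint_family_on (\<lambda>i. {u i<..<v i}) I"

text \<open>
  Remove the rightmost interval of the family: all the others lie to the left of it, so the
  statement for the smaller family may be used up to its left end point.
\<close>

lemma mono_on_sum_increments_le:
  fixes f :: "real \<Rightarrow> real" and u v :: "'i \<Rightarrow> real"
  assumes f: "mono_on {a..b} f" and "a \<le> b" and I: "disjoint_subintervals a b I u v"
  shows "(\<Sum>i\<in>I. f (v i) - f (u i)) \<le> f b - f a"
proof -
  have "finite I" "\<And>i. i \<in> I \<Longrightarrow> a \<le> u i \<and> u i < v i \<and> v i \<le> b"
    "disjoint_family_on (\<lambda>i. {u i<..<v i}) I" using I by (auto simp: disjoint_subintervals_def)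
  from this(1) f \<open>a \<le> b\<close> this(2,3) show ?thesis
  proof (induction "card I" arbitrary: I b)
    case 0
    then show ?case by (auto simp: mono_on_def)
  next
    case (Suc n)
    then have "I \<noteq> {}" by auto
    then have "Max (v ` I) \<in> v ` I" using Suc.prems(1) by (intro Max_in) auto
    then obtain j where j: "j \<in> I" "v j = Max (v ` I)" by auto
    have vj: "v i \<le> v j" if "i \<in> I" for i using j(2) that Suc.prems(1) by auto
    have "v i \<le> u j" if i: "i \<in> I - {j}" for i
    proof (rule ccontr)
      assume "\<not> v i \<le> u j"
      moreover have "u i < v i" "v i \<le> v j" "u j < v j"
        using Suc.prems(4)[of i] Suc.prems(4)[of j] vj i j(1) by auto
      ultimately obtain x where "max (u i) (u j) < x" "x < v i" "x < v j"
        using dense[of "max (u i) (u j)" "v i"] by auto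
      then have "x \<in> {u i<..<v i} \<inter> {u j<..<v j}" by auto
      moreover have "{u i<..<v i} \<inter> {u j<..<v j} = {}"
        using disjoint_family_onD[OF Suc.prems(5), of i j] i j(1) by auto
      ultimately show False by blast
    qed
    note left = this
    have rj: "a \<le> u j" "u j < v j" "v j \<le> b" using Suc.prems(4)[OF j(1)] by auto
    have "(\<Sum>i\<in>I - {j}. f (v i) - f (u i)) \<le> f (u j) - f a"
    proof (rule Suc.hyps(1))
      show "n = card (I - {j})" using Suc.hyps(2) j Suc.prems(1) by simp
      show "mono_on {a..u j} f" using Suc.prems(2) rj by (auto intro: monotone_on_subset)
      show "disjoint_family_on (\<lambda>i. {u i<..<v i}) (I - {j})"
        using Suc.prems(5) by (auto simp: disjoint_family_on_def)
    qed (use Suc.prems left rj in auto)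
    moreover have "f (v j) \<le> f b" using Suc.prems(2,3) rj by (auto simp: mono_on_def)
    moreover have "(\<Sum>i\<in>I. f (v i) - f (u i)) = f (v j) - f (u j) + (\<Sum>i\<in>I - {j}. f (v i) - f (u i))"
      using Suc.prems(1) j by (simp add: sum.remove)
    ultimately show ?case by linarith
  qed
qed

text \<open>
  A monotone function cannot be steep on a large set. A Vitali family of disjoint steep intervals
  covers almost all of \<open>S\<close>; its increments add up to at most \<open>f b - f a\<close>, and each of them exceeds
  \<open>q\<close> times the length of its interval. As \<open>S\<close> may fail to be measurable, its size
  is expressed by a measurable cover \<open>T\<close>.
\<close>

lemma mono_steep_points_measure:
  fixes f :: "real \<Rightarrow> real"
  assumes f: "mono f" and "a \<le> b" "q > 0" and S: "S \<subseteq> {a<..<b}"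
    and steep: "\<And>x. x \<in> S \<Longrightarrow> has_small_intervals (\<lambda>u v. f v - f u > q * (v - u)) x"
  obtains T where "S \<subseteq> T" "T \<in> lmeasurable" "q * measure lebesgue T \<le> f b - f a"
proof -
  obtain C where C: "countable C"
      "\<And>u v. (u, v) \<in> C \<Longrightarrow> u < v \<and> {u..v} \<subseteq> {a<..<b} \<and> f v - f u > q * (v - u)"
    "disjoint_family_on (\<lambda>(u, v). {u..v}) C" "negligible (S - (\<Union>(u, v)\<in>C. {u..v}))"
    by (rule Vitali_interval_cover[of "{a<..<b}" S "\<lambda>u v. f v - f u > q * (v - u)"])
      (use S steep in simp_all)
  define A where "A = (\<lambda>(u::real, v). {u..v})"
  have A: "A i \<in> lmeasurable" for i by (cases i) (simp add: A_def)
  have bound: "measure lebesgue (\<Union>i\<in>F. A i) \<le> (f b - f a) / q" if F: "F \<subseteq> C" "finite F" for F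
  proof -
    have "measure lebesgue (\<Union>i\<in>F. A i) \<le> (\<Sum>i\<in>F. measure lebesgue (A i))"
      using F A by (intro measure_UNION_le) (auto intro: fmeasurableD)
    also have "\<dots> = (\<Sum>i\<in>F. snd i - fst i)"
    proof (intro sum.cong refl)
      fix i assume "i \<in> F"
      then have "(fst i, snd i) \<in> C" using F by auto
      from C(2)[OF this] show "measure lebesgue (A i) = snd i - fst i"
        by (simp add: A_def split_beta)
    qed
    also have "\<dots> \<le> (\<Sum>i\<in>F. (f (snd i) - f (fst i)) / q)"
    proof (intro sum_mono)
      fix i assume "i \<in> F"
      then have "(fst i, snd i) \<in> C" using F by auto
      from C(2)[OF this] show "snd i - fst i \<le> (f (snd i) - f (fst i)) / q"
        using \<open>q > 0\<close> by (simp add: field_simps)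
    qed
    also have "\<dots> = (\<Sum>i\<in>F. f (snd i) - f (fst i)) / q"
      by (simp add: sum_divide_distrib)
    also have "\<dots> \<le> (f b - f a) / q"
    proof (intro divide_right_mono mono_on_sum_increments_le[where u = fst and v = snd])
      show "disjoint_subintervals a b F fst snd"
        unfolding disjoint_subintervals_def
      proof (intro conjI ballI)
        fix i assume i: "i \<in> F"
        have "(fst i, snd i) \<in> C" using i F by auto
        from C(2)[OF this] have lt: "fst i < snd i" and sub: "{fst i..snd i} \<subseteq> {a<..<b}" by auto
        from lt have "{fst i, snd i} \<subseteq> {fst i..snd i}" by auto
        from this sub have "{fst i, snd i} \<subseteq> {a<..<b}" by (rule order_trans)
        with lt show "a \<le> fst i" "fst i < snd i" "snd i \<le> b" by auto
      next
        show "disjoint_family_on (\<lambda>i. {fst i<..<snd i}) F"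
          unfolding disjoint_family_on_def
        proof (intro ballI impI)
          fix i j assume "i \<in> F" "j \<in> F" "i \<noteq> j"
          then have "A i \<inter> A j = {}" using disjoint_family_onD[OF C(3), of i j] F(1) by (auto simp: A_def)
          moreover have "{fst i<..<snd i} \<subseteq> A i" for i by (cases i) (auto simp: A_def)
          ultimately show "{fst i<..<snd i} \<inter> {fst j<..<snd j} = {}" by blast
        qed
      qed (rule F(2))
    next
      show "mono_on {a..b} f" by (rule monotone_on_subset[OF f subset_UNIV])
    qed (use F \<open>a \<le> b\<close> \<open>q > 0\<close> in simp_all)
    finally show ?thesis .
  qed
  let ?N = "S - (\<Union>i\<in>C. A i)"
  have UA: "(\<Union>i\<in>C. A i) \<in> lmeasurable" "measure lebesgue (\<Union>i\<in>C. A i) \<le> (f b - f a) / q"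
    by (rule fmeasurable_UN_bound[OF C(1) A bound]; assumption)
      (rule measure_UN_bound[OF C(1) A bound]; assumption)
  have N: "negligible ?N" using C(4) by (simp add: A_def)
  note NL = negligible_imp_measurable[OF N]
  show ?thesis
  proof
    show "S \<subseteq> (\<Union>i\<in>C. A i) \<union> ?N" by auto
    show "(\<Union>i\<in>C. A i) \<union> ?N \<in> lmeasurable"
      by (rule fmeasurable.Un[OF UA(1) NL])
    have "measure lebesgue ((\<Union>i\<in>C. A i) \<union> ?N) \<le> measure lebesgue (\<Union>i\<in>C. A i) + measure lebesgue ?N"
      by (rule measure_Un_le[OF fmeasurableD[OF UA(1)] fmeasurableD[OF NL]])
    also have "\<dots> \<le> (f b - f a) / q" using UA(2) negligible_imp_measure0[OF N] by linarith
    finally show "q * measure lebesgue ((\<Union>i\<in>C. A i) \<union> ?N) \<le> f b - f a"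
      using \<open>q > 0\<close> by (simp add: field_simps)
  qed
qed

section \<open>Lebesgue's theorem on monotone functions\<close>

lemma lmeasurable_outer_open:
  assumes T: "T \<in> lmeasurable" and "e > 0"
  obtains U where "open U" "T \<subseteq> U" "U \<in> lmeasurable" "measure lebesgue U < measure lebesgue T + e"
proof -
  obtain U where U: "open U" "T \<subseteq> U" "U - T \<in> lmeasurable" "emeasure lebesgue (U - T) < ennreal e"
    using sets_lebesgue_outer_open[OF fmeasurableD[OF T] \<open>e > 0\<close>] by blast
  have "measure lebesgue (U - T) < e"
    using U(4) \<open>e > 0\<close> emeasure_eq_measure2[OF U(3)] by (simp add: ennreal_less_iff)
  moreover have eq: "U = T \<union> (U - T)" using U(2) by auto
  moreover have "measure lebesgue (T \<union> (U - T)) \<le> measure lebesgue T + measure lebesgue (U - T)"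
    by (rule measure_Un_le[OF fmeasurableD[OF T] fmeasurableD[OF U(3)]])
  ultimately have "measure lebesgue U < measure lebesgue T + e" by simp
  moreover have "U \<in> lmeasurable" by (subst eq) (rule fmeasurable.Un[OF T U(3)])
  ultimately show ?thesis using U that by blast
qed

text \<open>
  The shrinking step of Lebesgue's theorem. Cover \<open>S\<close> by disjoint flat intervals inside an open set
  that is hardly larger than \<open>T\<close>. The increment of \<open>f\<close> over a flat interval \<open>i\<close> is below \<open>p\<close> times its
  length, hence by the bound on steep points those points of \<open>S\<close> inside \<open>i\<close> that are also steep,
  that is all of them, fit into a set of measure at most \<open>p / q\<close> times the length of \<open>i\<close>.
\<close>

lemma mono_oscillation_cover:
  fixes f :: "real \<Rightarrow> real"
  assumes f: "mono f" and pq: "0 < p" "p < q" and T: "T \<in> lmeasurable" "S \<subseteq> T" and "e > 0"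
    and flat: "\<And>x. x \<in> S \<Longrightarrow> has_small_intervals (\<lambda>u v. f v - f u < p * (v - u)) x"
    and steep: "\<And>x. x \<in> S \<Longrightarrow> has_small_intervals (\<lambda>u v. f v - f u > q * (v - u)) x"
  obtains T' where "S \<subseteq> T'" "T' \<in> lmeasurable"
    "measure lebesgue T' \<le> p / q * (measure lebesgue T + e)"
proof -
  obtain U where U: "open U" "T \<subseteq> U" "U \<in> lmeasurable" "measure lebesgue U < measure lebesgue T + e"
    using lmeasurable_outer_open[OF T(1) \<open>e > 0\<close>] .
  obtain C where C: "countable C"
      "\<And>u v. (u, v) \<in> C \<Longrightarrow> u < v \<and> {u..v} \<subseteq> U \<and> f v - f u < p * (v - u)"
    "disjoint_family_on (\<lambda>(u, v). {u..v}) C" "negligible (S - (\<Union>(u, v)\<in>C. {u..v}))"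
    by (rule Vitali_interval_cover[of U S "\<lambda>u v. f v - f u < p * (v - u)"])
      (use U(1) order_trans[OF T(2) U(2)] flat in simp_all)
  define A where "A = (\<lambda>(u::real, v). {u..v})"
  have A: "A i \<in> lmeasurable" for i by (cases i) (simp add: A_def)
  have Ci: "fst i < snd i \<and> A i \<subseteq> U \<and> f (snd i) - f (fst i) < p * (snd i - fst i)" if "i \<in> C" for i
    using C(2)[of "fst i" "snd i"] that by (cases i) (simp add: A_def)
  have "\<exists>B. S \<inter> {fst i<..<snd i} \<subseteq> B \<and> B \<in> lmeasurable
      \<and> measure lebesgue B \<le> p / q * measure lebesgue (A i)" if i: "i \<in> C" for i
  proof -
    obtain B where B: "S \<inter> {fst i<..<snd i} \<subseteq> B" "B \<in> lmeasurable"
      "q * measure lebesgue B \<le> f (snd i) - f (fst i)"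
      by (rule mono_steep_points_measure[of f "fst i" "snd i" q "S \<inter> {fst i<..<snd i}"])
        (use f Ci[OF i] pq steep in simp_all)
    have "q * measure lebesgue B \<le> p * (snd i - fst i)" using B(3) Ci[OF i] by linarith
    also have "snd i - fst i = measure lebesgue (A i)" using Ci[OF i] by (simp add: A_def split_beta)
    finally have "measure lebesgue B \<le> p / q * measure lebesgue (A i)"
      using pq by (simp add: field_simps)
    with B show ?thesis by blast
  qed
  then obtain B where B: "\<And>i. i \<in> C \<Longrightarrow> S \<inter> {fst i<..<snd i} \<subseteq> B i"
    "\<And>i. i \<in> C \<Longrightarrow> B i \<in> lmeasurable"
    "\<And>i. i \<in> C \<Longrightarrow> measure lebesgue (B i) \<le> p / q * measure lebesgue (A i)"
    by metis
  have bound: "measure lebesgue (\<Union>i\<in>F. B i) \<le> p / q * measure lebesgue U"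
    if F: "F \<subseteq> C" "finite F" for F
  proof -
    have "measure lebesgue (\<Union>i\<in>F. B i) \<le> (\<Sum>i\<in>F. measure lebesgue (B i))"
      by (rule measure_UNION_le[OF F(2)]) (use B(2) F(1) in \<open>blast intro: fmeasurableD\<close>)
    also have "\<dots> \<le> (\<Sum>i\<in>F. p / q * measure lebesgue (A i))"
      by (rule sum_mono) (use B(3) F(1) in blast)
    also have "\<dots> = p / q * (\<Sum>i\<in>F. measure lebesgue (A i))" by (simp add: sum_distrib_left)
    also have "(\<Sum>i\<in>F. measure lebesgue (A i)) = measure lebesgue (\<Union>i\<in>F. A i)"
    proof (rule measure_finite_Union[symmetric])
      show "disjoint_family_on A F"
        using C(3) F(1) unfolding A_def by (rule disjoint_family_on_mono[rotated])
      show "A ` F \<subseteq> sets lebesgue" using A by (blast intro: fmeasurableD)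
      show "emeasure lebesgue (A i) \<noteq> \<infinity>" for i using fmeasurableD2[OF A[of i]] by simp
    qed (use F in auto)
    also have "\<dots> \<le> measure lebesgue U"
    proof (rule measure_mono_fmeasurable[OF _ _ U(3)])
      show "\<Union> (A ` F) \<subseteq> U" using Ci F by blast
      show "\<Union> (A ` F) \<in> sets lebesgue"
        using F(2) A by (blast intro: fmeasurableD sets.finite_UN)
    qed
    finally show ?thesis using pq by (simp add: mult_left_mono divide_right_mono)
  qed
  have UB: "(\<Union>i\<in>C. B i) \<in> lmeasurable" "measure lebesgue (\<Union>i\<in>C. B i) \<le> p / q * measure lebesgue U"
    by (rule fmeasurable_UN_bound[OF C(1) B(2) bound]; assumption)
      (rule measure_UN_bound[OF C(1) B(2) bound]; assumption)
  \<comment> \<open>The steep cover is available inside the open intervals only, so their end points join the exceptional set.\<close>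
  define N where "N = (S - (\<Union>i\<in>C. A i)) \<union> (fst ` C \<union> snd ` C)"
  have "negligible (fst ` C \<union> snd ` C)"
    unfolding negligible_iff_null_sets
    using C(1) by (intro null_sets_completionI countable_imp_null_set_lborel) auto
  then have N: "negligible N" using C(4) unfolding N_def A_def by (rule negligible_Un[rotated])
  note NL = negligible_imp_measurable[OF N]
  show ?thesis
  proof
    show "S \<subseteq> (\<Union>i\<in>C. B i) \<union> N"
    proof
      fix x assume x: "x \<in> S"
      show "x \<in> (\<Union>i\<in>C. B i) \<union> N"
      proof (cases "\<exists>i\<in>C. x \<in> A i")
        case True
        then obtain i where i: "i \<in> C" "x \<in> A i" by blast
        then have "x = fst i \<or> x = snd i \<or> x \<in> {fst i<..<snd i}" by (auto simp: A_def split_beta)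
        then show ?thesis using B(1)[OF i(1)] i x by (auto simp: N_def)
      qed (use x in \<open>auto simp: N_def\<close>)
    qed
    show "(\<Union>i\<in>C. B i) \<union> N \<in> lmeasurable" by (rule fmeasurable.Un[OF UB(1) NL])
    have "measure lebesgue ((\<Union>i\<in>C. B i) \<union> N) \<le> measure lebesgue (\<Union>i\<in>C. B i) + measure lebesgue N"
      by (rule measure_Un_le[OF fmeasurableD[OF UB(1)] fmeasurableD[OF NL]])
    also have "\<dots> \<le> p / q * measure lebesgue U" using UB(2) negligible_imp_measure0[OF N] by linarith
    also have "\<dots> \<le> p / q * (measure lebesgue T + e)"
      using U(4) pq by (intro mult_left_mono) auto
    finally show "measure lebesgue ((\<Union>i\<in>C. B i) \<union> N) \<le> p / q * (measure lebesgue T + e)" .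
  qed
qed

text \<open>
  A set of positive outer measure \<open>m\<close> would have a cover of measure close to \<open>m\<close>, which
  the previous lemma shrinks by the factor \<open>p / q < 1\<close> to a cover of measure below \<open>m\<close>.
\<close>

lemma mono_oscillation_negligible:
  fixes f :: "real \<Rightarrow> real"
  assumes f: "mono f" and pq: "0 < p" "p < q"
  shows "negligible {x. has_small_intervals (\<lambda>u v. f v - f u < p * (v - u)) x \<and>
                        has_small_intervals (\<lambda>u v. f v - f u > q * (v - u)) x}"
proof (subst negligible_on_intervals, intro allI)
  fix a b :: real
  let ?E = "{x. has_small_intervals (\<lambda>u v. f v - f u < p * (v - u)) x \<and>
                has_small_intervals (\<lambda>u v. f v - f u > q * (v - u)) x}"
  define S where "S = ?E \<inter> cbox a b"
  define X where "X = measure lebesgue ` {T. T \<in> lmeasurable \<and> S \<subseteq> T}"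
  define m where "m = Inf X"
  have "cbox a b \<in> lmeasurable" "S \<subseteq> cbox a b" by (auto simp: S_def)
  then have X: "X \<noteq> {}" by (auto simp: X_def)
  have bdd: "bdd_below X" by (rule bdd_belowI[of _ 0]) (auto simp: X_def)
  have m0: "m \<ge> 0" unfolding m_def using X by (intro cInf_greatest) (auto simp: X_def)
  have "m = 0"
  proof (rule ccontr)
    assume "m \<noteq> 0"
    with m0 have m: "m > 0" by simp
    \<comment> \<open>Small enough for p / q * (m + 2 * e) < m: the left side is the mean of m and m * p / q.\<close>
    define e where "e = m * (q - p) / (4 * p)"
    have e: "e > 0" using m pq by (simp add: e_def)
    have "\<exists>z\<in>X. z < m + e" unfolding m_def using X e by (intro cInf_lessD) auto
    then obtain T where T: "T \<in> lmeasurable" "S \<subseteq> T" "measure lebesgue T < m + e"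
      by (auto simp: X_def)
    obtain T' where T': "S \<subseteq> T'" "T' \<in> lmeasurable"
      "measure lebesgue T' \<le> p / q * (measure lebesgue T + e)"
      by (rule mono_oscillation_cover[OF f pq T(1,2) e]) (auto simp: S_def)
    have "m \<le> measure lebesgue T'"
      unfolding m_def using bdd T' by (intro cInf_lower) (auto simp: X_def)
    also have "\<dots> \<le> p / q * (measure lebesgue T + e)" by fact
    also have "\<dots> < p / q * (m + 2 * e)" using T(3) pq by (intro mult_strict_left_mono) auto
    also have "\<dots> = m * (p + q) / (2 * q)" using pq by (simp add: e_def field_simps)
    also have "\<dots> < m" using m pq by (simp add: field_simps)
    finally show False .
  qed
  show "negligible (?E \<inter> cbox a b)"
    unfolding S_def[symmetric] negligible_outer
  proof (intro allI impI)
    fix e :: real assume "e > 0"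
    then have "\<exists>z\<in>X. z < e" using X \<open>m = 0\<close> unfolding m_def by (intro cInf_lessD) auto
    then show "\<exists>T. S \<subseteq> T \<and> T \<in> lmeasurable \<and> measure lebesgue T < e" by (auto simp: X_def)
  qed
qed

text \<open>
  The points with arbitrarily steep small intervals satisfy the steepness bound for every \<open>n\<close>,
  so within a bounded interval they have outer measure at most a constant over \<open>n\<close>.
\<close>

lemma mono_infinite_slope_negligible:
  fixes f :: "real \<Rightarrow> real"
  assumes f: "mono f"
  shows "negligible {x. \<forall>n::nat. has_small_intervals (\<lambda>u v. f v - f u > real n * (v - u)) x}"
proof (subst negligible_on_intervals, intro allI)
  fix a b :: real
  let ?E = "{x. \<forall>n::nat. has_small_intervals (\<lambda>u v. f v - f u > real n * (v - u)) x}"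
  let ?c = "min a b - 1" and ?d = "max a b + 1"
  show "negligible (?E \<inter> cbox a b)"
    unfolding negligible_outer_le
  proof (intro allI impI)
    fix e :: real assume e: "e > 0"
    obtain n :: nat where n: "(f ?d - f ?c) / e < real n" using reals_Archimedean2 by blast
    define k where "k = Suc n"
    have k: "(f ?d - f ?c) / e < real k" "real k > 0" using n by (auto simp: k_def)
    obtain T where T: "?E \<inter> cbox a b \<subseteq> T" "T \<in> lmeasurable" "real k * measure lebesgue T \<le> f ?d - f ?c"
    proof (rule mono_steep_points_measure[of f ?c ?d "real k" "?E \<inter> cbox a b"])
      show "?E \<inter> cbox a b \<subseteq> {?c<..<?d}" by auto
    qed (use f k in auto)
    have "f ?d - f ?c \<le> real k * e" using k e by (simp add: pos_divide_less_eq)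
    with T(3) have "real k * measure lebesgue T \<le> real k * e" by (rule order_trans)
    with k(2) have "measure lebesgue T \<le> e" by simp
    with T show "\<exists>T. ?E \<inter> cbox a b \<subseteq> T \<and> T \<in> lmeasurable \<and> measure lebesgue T \<le> e" by blast
  qed
qed

text \<open>
  The derivative is the supremum of the eventual lower bounds of the slopes. Any rational \<open>p\<close>
  above that supremum is undercut by arbitrarily small intervals, and then, by the stability hypothesis, any
  rational \<open>q > p\<close> is an eventual upper bound.
\<close>

lemma differentiable_if_slopes_converge:
  fixes f :: "real \<Rightarrow> real"
  assumes f: "mono f"
    and finite_slope: "\<not> has_small_intervals (\<lambda>u v. f v - f u > real n * (v - u)) x"
    and stable: "\<And>p q. \<lbrakk>p \<in> \<rat>; q \<in> \<rat>; 0 < p; p < q;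
        has_small_intervals (\<lambda>u v. f v - f u < p * (v - u)) x\<rbrakk>
      \<Longrightarrow> \<not> has_small_intervals (\<lambda>u v. f v - f u > q * (v - u)) x"
  shows "f differentiable (at x)"
proof -
  define X where "X = {c. \<not> has_small_intervals (\<lambda>u v. f v - f u < c * (v - u)) x}"
  define L where "L = Sup X"
  have X0: "0 \<in> X" using f by (auto simp: X_def has_small_intervals_def mono_def not_less intro: zero_less_one)
  obtain d0 where d0: "d0 > 0"
    "\<And>u v. \<lbrakk>u < v; u \<le> x; x \<le> v; v - u < d0\<rbrakk> \<Longrightarrow> f v - f u \<le> real n * (v - u)"
    using finite_slope by (rule not_has_small_intervalsE) (simp add: not_less)
  have Xn: "c \<le> real n" if cX: "c \<in> X" for c
  proof -
    obtain d where d: "d > 0"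
      "\<And>u v. \<lbrakk>u < v; u \<le> x; x \<le> v; v - u < d\<rbrakk> \<Longrightarrow> c * (v - u) \<le> f v - f u"
      using cX unfolding X_def mem_Collect_eq by (rule not_has_small_intervalsE) (simp add: not_less)
    let ?h = "min d d0 / 2"
    have "c * ?h \<le> f (x + ?h) - f x" using d(2)[of x "x + ?h"] d(1) d0(1) by simp
    also have "\<dots> \<le> real n * ?h" using d0(2)[of x "x + ?h"] d(1) d0(1) by simp
    finally show ?thesis using d(1) d0(1) by simp
  qed
  have bdd: "bdd_above X" using Xn by (rule bdd_aboveI)
  have L0: "L \<ge> 0" unfolding L_def using bdd X0 by (rule cSup_upper[rotated])
  have "((\<lambda>y. (f y - f x) / (y - x)) \<longlongrightarrow> L) (at x)"
  proof (rule tendstoI)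
    fix e :: real assume e: "e > 0"
    obtain c where c: "c \<in> X" "L - e < c"
      using less_cSupD[of X "L - e"] X0 e by (auto simp: L_def)
    obtain d where d: "d > 0"
      "\<And>u v. \<lbrakk>u < v; u \<le> x; x \<le> v; v - u < d\<rbrakk> \<Longrightarrow> c * (v - u) \<le> f v - f u"
      using c(1) unfolding X_def mem_Collect_eq by (rule not_has_small_intervalsE) (simp add: not_less)
    obtain p where p: "p \<in> \<rat>" "L < p" "p < L + e" using Rats_dense_in_real[of L "L + e"] e by auto
    obtain q where q: "q \<in> \<rat>" "p < q" "q < L + e" using Rats_dense_in_real[OF p(3)] by auto
    have "p \<notin> X" using cSup_upper[OF _ bdd, of p] p(2) by (auto simp: L_def)
    then have "has_small_intervals (\<lambda>u v. f v - f u < p * (v - u)) x" by (simp add: X_def)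
    then have "\<not> has_small_intervals (\<lambda>u v. f v - f u > q * (v - u)) x"
      using stable[of p q] p q L0 by auto
    then obtain d' where d': "d' > 0"
      "\<And>u v. \<lbrakk>u < v; u \<le> x; x \<le> v; v - u < d'\<rbrakk> \<Longrightarrow> f v - f u \<le> q * (v - u)"
      by (rule not_has_small_intervalsE) (simp add: not_less)
    show "\<forall>\<^sub>F y in at x. dist ((f y - f x) / (y - x)) L < e"
      unfolding eventually_at
    proof (intro exI[of _ "min d d'"] conjI ballI impI)
      show "min d d' > 0" using d d' by simp
      fix y assume y: "y \<noteq> x \<and> dist y x < min d d'"
      have "c \<le> (f y - f x) / (y - x) \<and> (f y - f x) / (y - x) \<le> q"
      proof (cases "x < y")
        case True
        then show ?thesis using d(2)[of x y] d'(2)[of x y] y by (simp add: dist_real_def field_simps)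
      next
        case False
        then have "y < x" using y by simp
        moreover have "(f y - f x) / (y - x) = (f x - f y) / (x - y)"
          by (metis minus_diff_eq minus_divide_divide)
        ultimately show ?thesis
          using d(2)[of y x] d'(2)[of y x] y by (simp add: dist_real_def field_simps)
      qed
      then show "dist ((f y - f x) / (y - x)) L < e" using c(2) q(3) by (auto simp: dist_real_def)
    qed
  qed
  then have "(f has_field_derivative L) (at x)" by (simp add: has_field_derivative_iff)
  then show ?thesis by (auto simp: real_differentiable_def)
qed

text \<open>
  Lebesgue's theorem: outside countably many negligible sets, one for each pair of rationals and one
  for infinite slopes, the slopes converge.
\<close>

theorem mono_differentiable_ae:
  fixes f :: "real \<Rightarrow> real"
  assumes f: "mono f"
  shows "negligible {x. \<not> f differentiable (at x)}"
proof -
  define E where "E = (\<lambda>(p, q). {x. has_small_intervals (\<lambda>u v. f v - f u < p * (v - u)) x \<and>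
      has_small_intervals (\<lambda>u v. f v - f u > q * (v - u)) x})"
  define R where "R = {(p, q). p \<in> \<rat> \<and> q \<in> \<rat> \<and> 0 < p \<and> p < (q::real)}"
  have "countable R"
    by (rule countable_subset[of _ "\<rat> \<times> \<rat>"]) (auto simp: R_def intro: countable_SIGMA countable_rat)
  then have "negligible (\<Union>(E ` R))"
    by (rule negligible_countable_Union[OF countable_image])
      (auto simp: R_def E_def intro!: mono_oscillation_negligible[OF f])
  then have "negligible (\<Union>(E ` R) \<union>
      {x. \<forall>n::nat. has_small_intervals (\<lambda>u v. f v - f u > real n * (v - u)) x})"
    by (rule negligible_Un[OF _ mono_infinite_slope_negligible[OF f]])
  then show ?thesis
  proof (rule negligible_subset, intro subsetI)
    fix x assume x: "x \<in> {x. \<not> f differentiable (at x)}"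
    show "x \<in> \<Union>(E ` R) \<union> {x. \<forall>n::nat. has_small_intervals (\<lambda>u v. f v - f u > real n * (v - u)) x}"
    proof (rule ccontr)
      assume "\<not> ?thesis"
      then obtain n :: nat where
        n: "\<not> has_small_intervals (\<lambda>u v. f v - f u > real n * (v - u)) x" and E: "x \<notin> \<Union>(E ` R)" by blast
      have "f differentiable (at x)"
      proof (rule differentiable_if_slopes_converge[OF f n])
        fix p q :: real
        assume "p \<in> \<rat>" "q \<in> \<rat>" "0 < p" "p < q"
        then have "(p, q) \<in> R" by (simp add: R_def)
        with E have "x \<notin> E (p, q)" by blast
        then show "has_small_intervals (\<lambda>u v. f v - f u < p * (v - u)) x \<Longrightarrow>
          \<not> has_small_intervals (\<lambda>u v. f v - f u > q * (v - u)) x" by (simp add: E_def)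
      qed
      with x show False by simp
    qed
  qed
qed

section \<open>Absolutely continuous functions are differentiable almost everywhere\<close>

definition variation_sums :: "(real \<Rightarrow> real) \<Rightarrow> real \<Rightarrow> real \<Rightarrow> real set" where
  "variation_sums f a b =
    {\<Sum>i<n. \<bar>f (v i) - f (u i)\<bar> | (n::nat) u v. disjoint_subintervals a b {..<n} u v}"

lemma zero_in_variation_sums: "0 \<in> variation_sums f a b"
  unfolding variation_sums_def
  by (rule CollectI, rule exI[of _ 0]) (simp add: disjoint_subintervals_def disjoint_family_on_def)

lemma variation_sums_extend:
  assumes s: "s \<in> variation_sums f a x" and xy: "a \<le> x" "x < y"
  shows "s + \<bar>f y - f x\<bar> \<in> variation_sums f a y"
proof -
  obtain n :: nat and u v where uv: "disjoint_subintervals a x {..<n} u v"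
      "s = (\<Sum>i<n. \<bar>f (v i) - f (u i)\<bar>)"
    using s unfolding variation_sums_def by blast
  have le: "a \<le> u i" "u i < v i" "v i \<le> x" if "i < n" for i
    using uv(1) that by (auto simp: disjoint_subintervals_def)
  let ?u = "u(n := x)" and ?v = "v(n := y)"
  have "disjoint_subintervals a y {..<Suc n} ?u ?v"
    unfolding disjoint_subintervals_def
  proof (intro conjI ballI)
    fix i assume "i \<in> {..<Suc n}"
    then have "i < n \<or> i = n" by auto
    then show "a \<le> ?u i" "?u i < ?v i" "?v i \<le> y" using le[of i] xy by auto
  next
    show "disjoint_family_on (\<lambda>i. {?u i<..<?v i}) {..<Suc n}"
      unfolding lessThan_Suc
    proof (subst disjoint_family_on_insert, simp, intro conjI)
      show "{?u n<..<?v n} \<inter> (\<Union>i\<in>{..<n}. {?u i<..<?v i}) = {}" using le by fastforce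
      show "disjoint_family_on (\<lambda>i. {?u i<..<?v i}) {..<n}"
        using uv(1) by (simp add: disjoint_subintervals_def disjoint_family_on_def)
    qed
  qed simp
  moreover have "s + \<bar>f y - f x\<bar> = (\<Sum>i<Suc n. \<bar>f (?v i) - f (?u i)\<bar>)"
    using uv(2) by simp
  ultimately show ?thesis unfolding variation_sums_def by blast
qed

lemma variation_sums_mono: "b \<le> c \<Longrightarrow> variation_sums f a b \<subseteq> variation_sums f a c"
  unfolding variation_sums_def disjoint_subintervals_def by (blast intro: order_trans)

text \<open>
  Jordan decomposition: the increments of the variation \<open>V x\<close> on \<open>{a..x}\<close> dominate those of \<open>f\<close> in absolute value, so both
  \<open>V\<close> and \<open>V - f\<close> are monotone. Clamping the argument to \<open>{a..b}\<close> makes them monotone on the whole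
  line without changing them on \<open>{a<..<b}\<close>.
\<close>

theorem bounded_variation_differentiable_ae:
  fixes f :: "real \<Rightarrow> real"
  assumes "a \<le> b" and B: "\<And>s. s \<in> variation_sums f a b \<Longrightarrow> s \<le> B"
  shows "negligible {x \<in> {a<..<b}. \<not> f differentiable (at x)}"
proof -
  define V where "V x = Sup (variation_sums f a x)" for x
  define c where "c x = max a (min b x)" for x
  have c: "c x \<in> {a..b}" "x \<le> y \<Longrightarrow> c x \<le> c y" for x y using \<open>a \<le> b\<close> by (auto simp: c_def)
  have V: "V x + \<bar>f y - f x\<bar> \<le> V y" if xy: "a \<le> x" "x \<le> y" "y \<le> b" for x y
  proof (cases "x = y")
    case False
    have bdd: "bdd_above (variation_sums f a y)"
      using B variation_sums_mono[OF xy(3)] by (intro bdd_aboveI[of _ B]) blast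
    have "V x \<le> V y - \<bar>f y - f x\<bar>"
      unfolding V_def
    proof (rule cSup_least)
      show "variation_sums f a x \<noteq> {}" using zero_in_variation_sums by blast
      fix s assume "s \<in> variation_sums f a x"
      then have "s + \<bar>f y - f x\<bar> \<in> variation_sums f a y"
        using xy False by (intro variation_sums_extend) auto
      then have "s + \<bar>f y - f x\<bar> \<le> Sup (variation_sums f a y)" using bdd by (rule cSup_upper)
      then show "s \<le> Sup (variation_sums f a y) - \<bar>f y - f x\<bar>" by simp
    qed
    then show ?thesis by simp
  qed simp
  define g h where "g x = V (c x)" and "h x = V (c x) - f (c x)" for x
  have gh: "g x \<le> g y \<and> h x \<le> h y" if "x \<le> y" for x y
    using V[of "c x" "c y"] c(1)[of x] c(1)[of y] c(2)[OF that] by (auto simp: g_def h_def)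
  then have mono: "mono g" "mono h" by (auto intro: monoI)
  have "negligible ({x. \<not> g differentiable (at x)} \<union> {x. \<not> h differentiable (at x)})"
    by (intro negligible_Un mono_differentiable_ae mono)
  then show ?thesis
  proof (rule negligible_subset, intro subsetI)
    fix x assume "x \<in> {x \<in> {a<..<b}. \<not> f differentiable (at x)}"
    then have x: "x \<in> {a<..<b}" "\<not> f differentiable (at x)" by auto
    show "x \<in> {x. \<not> g differentiable (at x)} \<union> {x. \<not> h differentiable (at x)}"
    proof (rule ccontr)
      assume "\<not> ?thesis"
      then have "(\<lambda>x. g x - h x) differentiable (at x)" by (auto intro: differentiable_diff)
      then obtain D where "((\<lambda>x. g x - h x) has_derivative D) (at x)" by (auto simp: differentiable_def)
      then have "(f has_derivative D) (at x)"
        by (rule has_derivative_transform_within_open[where s = "{a<..<b}"])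
          (use x in \<open>auto simp: g_def h_def c_def\<close>)
      with x(2) show False by (auto simp: differentiable_def)
    qed
  qed
qed

text \<open>
  Absolute continuity for families over arbitrary finite index sets, so that the
  intervals of a tagged division can serve as their own indices.
\<close>

lemma abs_continuous_on_interval_finite_families:
  assumes "abs_continuous_on_interval f a b" "\<epsilon> > 0"
  shows "\<exists>\<delta>>0. \<forall>(I :: 'i set) u v. disjoint_subintervals a b I u v \<longrightarrow>
    (\<Sum>i\<in>I. v i - u i) < \<delta> \<longrightarrow> (\<Sum>i\<in>I. \<bar>f (v i) - f (u i)\<bar>) < \<epsilon>"
proof -
  define Q where "Q \<delta> \<longleftrightarrow> (\<forall>(n::nat) u v. (\<forall>i<n. a \<le> u i \<and> u i < v i \<and> v i \<le> b) \<longrightarrow>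
      disjoint_family_on (\<lambda>i. {u i<..<v i}) {..<n} \<longrightarrow> (\<Sum>i<n. v i - u i) < \<delta> \<longrightarrow>
      (\<Sum>i<n. \<bar>f (v i) - f (u i)\<bar>) < \<epsilon>)" for \<delta>
  have "\<exists>\<delta>>0. Q \<delta>"
    unfolding Q_def
    by (rule assms(1)[unfolded abs_continuous_on_interval_def, THEN spec, THEN mp, OF assms(2)])
  then obtain \<delta> where \<delta>: "\<delta> > 0" "Q \<delta>" by blast
  note Q = \<delta>(2)[unfolded Q_def, THEN spec, THEN spec, THEN spec, THEN mp, THEN mp, THEN mp]
  show ?thesis
  proof (rule exI[of _ \<delta>], intro conjI \<delta>(1) allI impI)
    fix I :: "'i set" and u v
    assume I: "disjoint_subintervals a b I u v" and less: "(\<Sum>i\<in>I. v i - u i) < \<delta>"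
    have le: "a \<le> u i \<and> u i < v i \<and> v i \<le> b" if "i \<in> I" for i
      using I that by (simp add: disjoint_subintervals_def)
    have disj: "disjoint_family_on (\<lambda>i. {u i<..<v i}) I" and "finite I"
      using I by (simp_all add: disjoint_subintervals_def)
    then obtain e where e: "bij_betw e {..<card I} I"
      using ex_bij_betw_nat_finite[of I] by (auto simp: atLeast0LessThan)
    have eI: "e k \<in> I" if "k < card I" for k using bij_betwE[OF e] that by auto
    have "(\<Sum>k<card I. \<bar>f (v (e k)) - f (u (e k))\<bar>) < \<epsilon>"
    proof (rule Q)
      show "\<forall>k<card I. a \<le> u (e k) \<and> u (e k) < v (e k) \<and> v (e k) \<le> b"
        using le eI by simp
      show "disjoint_family_on (\<lambda>k. {u (e k)<..<v (e k)}) {..<card I}"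
        unfolding disjoint_family_on_def
      proof (intro ballI impI)
        fix k l assume kl: "k \<in> {..<card I}" "l \<in> {..<card I}" "k \<noteq> l"
        then have "e k \<noteq> e l" using e by (auto simp: bij_betw_def inj_on_def)
        then show "{u (e k)<..<v (e k)} \<inter> {u (e l)<..<v (e l)} = {}"
          using disjoint_family_onD[OF disj, of "e k" "e l"] eI kl by auto
      qed
      show "(\<Sum>k<card I. v (e k) - u (e k)) < \<delta>"
        using less sum.reindex_bij_betw[OF e, of "\<lambda>i. v i - u i"] by simp
    qed
    then show "(\<Sum>i\<in>I. \<bar>f (v i) - f (u i)\<bar>) < \<epsilon>"
      using sum.reindex_bij_betw[OF e, of "\<lambda>i. \<bar>f (v i) - f (u i)\<bar>"] by simp
  qed
qed

text \<open>
  Differentiability is local, and on an interval shorter than the \<open>\<delta>\<close> belonging to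
  \<open>\<epsilon> = 1\<close> every variation sum is below 1.
\<close>

theorem abs_continuous_differentiable_ae:
  assumes f: "abs_continuous f"
  shows "negligible {x. \<not> f differentiable (at x)}"
proof (rule locally_negligible_alt[THEN iffD2], intro ballI)
  fix x assume x: "x \<in> {x. \<not> f differentiable (at x)}"
  have ac: "abs_continuous_on_interval f (x - 1) (x + 1)" using f by (simp add: abs_continuous_def)
  obtain \<delta> where \<delta>: "\<delta> > 0 \<and> (\<forall>(I :: nat set) u v. disjoint_subintervals (x - 1) (x + 1) I u v \<longrightarrow>
      (\<Sum>i\<in>I. v i - u i) < \<delta> \<longrightarrow> (\<Sum>i\<in>I. \<bar>f (v i) - f (u i)\<bar>) < 1)"
    using abs_continuous_on_interval_finite_families[OF ac zero_less_one] ..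
  note \<delta>_small = conjunct2[OF \<delta>, THEN spec, THEN spec, THEN spec, THEN mp, THEN mp]
  define r where "r = min 1 (\<delta> / 3)"
  have r: "r > 0" "r \<le> 1" "2 * r < \<delta>" using conjunct1[OF \<delta>] by (auto simp: r_def)
  have "s \<le> 1" if s: "s \<in> variation_sums f (x - r) (x + r)" for s
  proof -
    obtain n :: nat and u v where uv: "disjoint_subintervals (x - r) (x + r) {..<n} u v"
      "s = (\<Sum>i<n. \<bar>f (v i) - f (u i)\<bar>)"
      using s unfolding variation_sums_def by blast
    have "(\<Sum>i<n. v i - u i) \<le> (x + r) - (x - r)"
      by (rule mono_on_sum_increments_le[where f = "\<lambda>x. x"]) (use uv r in \<open>auto simp: mono_on_def\<close>)
    also have "\<dots> < \<delta>" using r by simp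
    finally have len: "(\<Sum>i<n. v i - u i) < \<delta>" .
    have "disjoint_subintervals (x - 1) (x + 1) {..<n} u v"
      using uv(1) r(2) by (force simp: disjoint_subintervals_def)
    then have "(\<Sum>i<n. \<bar>f (v i) - f (u i)\<bar>) < 1" using len by (rule \<delta>_small)
    with uv(2) show ?thesis by simp
  qed
  then have "negligible {y \<in> {x - r<..<x + r}. \<not> f differentiable (at y)}"
    using r by (intro bounded_variation_differentiable_ae[of _ _ _ 1]) auto
  moreover have "{y \<in> {x - r<..<x + r}. \<not> f differentiable (at y)} =
      {x. \<not> f differentiable (at x)} \<inter> {x - r<..<x + r}" by auto
  moreover have "openin (top_of_set {x. \<not> f differentiable (at x)})
      ({x. \<not> f differentiable (at x)} \<inter> {x - r<..<x + r})"
    by (rule openin_open_Int) simp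
  ultimately show "\<exists>U. openin (top_of_set {x. \<not> f differentiable (at x)}) U \<and> x \<in> U \<and> negligible U"
    using x r by (intro exI[of _ "{x. \<not> f differentiable (at x)} \<inter> {x - r<..<x + r}"]) auto
qed

section \<open>The fundamental theorem of calculus\<close>

text \<open>
  The Henstock-Kurzweil integral is suited to this: choose a gauge which at a point outside
  \<open>N\<close> expresses differentiability with error \<open>e1\<close>, and at a point of \<open>N\<close> keeps the interval inside an
  open set \<open>G\<close> around \<open>N\<close> of small measure. In a fine division the regular intervals contribute an error of at most
  \<open>e1 * (b - a)\<close>, and the others have small total length, so absolute continuity bounds the sum of their
  increments.
\<close>

theorem abs_continuous_FTC:
  fixes F :: "real \<Rightarrow> real"
  assumes ac: "abs_continuous_on_interval F a b" and ab: "a \<le> b" and N: "negligible N"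
    and deriv: "\<And>x. x \<in> {a..b} - N \<Longrightarrow> (F has_field_derivative g x) (at x)"
  shows "(g has_integral F b - F a) {a..b}"
proof -
  define g' where "g' x = (if x \<in> N then 0 else g x)" for x
  have "(g' has_integral F b - F a) {a..b}"
    unfolding has_integral_real
  proof (intro allI impI)
    fix e :: real assume e: "e > 0"
    define e1 where "e1 = e / (2 * (b - a + 1))"
    have e1: "e1 > 0" "e1 * (b - a) < e / 2" using e ab by (auto simp: e1_def field_simps)
    obtain \<delta> where \<delta>: "\<delta> > 0 \<and> (\<forall>(I :: (real \<times> real set) set) u v. disjoint_subintervals a b I u v \<longrightarrow>
        (\<Sum>i\<in>I. v i - u i) < \<delta> \<longrightarrow> (\<Sum>i\<in>I. \<bar>F (v i) - F (u i)\<bar>) < e / 2)"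
      using abs_continuous_on_interval_finite_families[OF ac half_gt_zero[OF e]] ..
    note \<delta>_small = conjunct2[OF \<delta>, THEN spec, THEN spec, THEN spec, THEN mp, THEN mp]
    obtain G where G: "open G" "N \<subseteq> G" "G \<in> lmeasurable" "measure lebesgue G < \<delta>"
      by (rule lmeasurable_outer_open[OF negligible_imp_measurable[OF N] conjunct1[OF \<delta>]])
        (simp add: negligible_imp_measure0[OF N])
    have "\<exists>d>0. \<forall>y. \<bar>y - x\<bar> < d \<longrightarrow> \<bar>F y - F x - g x * (y - x)\<bar> \<le> e1 * \<bar>y - x\<bar>"
      if "x \<in> {a..b} - N" for x
    proof -
      have "(F has_derivative (*) (g x)) (at x)"
        using deriv[OF that] by (simp add: has_field_derivative_def)
      then show ?thesis using e1(1) unfolding has_derivative_at_alt by (simp add: real_norm_def)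
    qed
    then obtain r where r: "\<And>x. x \<in> {a..b} - N \<Longrightarrow> r x > 0" "\<And>x y. \<lbrakk>x \<in> {a..b} - N; \<bar>y - x\<bar> < r x\<rbrakk>
        \<Longrightarrow> \<bar>F y - F x - g x * (y - x)\<bar> \<le> e1 * \<bar>y - x\<bar>" by metis
    define \<gamma> where "\<gamma> x = (if x \<in> N then G else ball x (if x \<in> {a..b} then r x else 1))" for x
    have gauge: "gauge \<gamma>" using G r(1) by (auto simp: gauge_def \<gamma>_def)
    have riemann_sum: "norm (sum (\<lambda>(x, K). measure lborel K *\<^sub>R g' x) p - (F b - F a)) < e"
      if p: "p tagged_division_of {a..b}" and fine: "\<gamma> fine p" for p
    proof -
      define lo hi where "lo i = Inf (snd i)" and "hi i = Sup (snd i)" for i :: "real \<times> real set"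
      have fin: "finite p" using p by (rule tagged_division_of_finite)
      have K: "snd i = {lo i..hi i}" "lo i \<le> fst i" "fst i \<le> hi i" "a \<le> lo i" "hi i \<le> b"
        "measure lborel (snd i) = hi i - lo i" "{lo i..hi i} \<subseteq> \<gamma> (fst i)" if i: "i \<in> p" for i
      proof -
        obtain x K where xK: "i = (x, K)" by (cases i)
        obtain u v where uv: "K = {u..v}" "x \<in> K" "K \<subseteq> {a..b}"
          using tagged_division_ofD(2-4)[OF p, of x K] i xK by (metis interval_cbox)
        then have le: "u \<le> v" by auto
        then have "Inf K = u" "Sup K = v" using uv by auto
        moreover have "K \<subseteq> \<gamma> x" using fine i xK by (auto simp: fine_def)
        ultimately show "snd i = {lo i..hi i}" "lo i \<le> fst i" "fst i \<le> hi i" "a \<le> lo i" "hi i \<le> b"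
          "measure lborel (snd i) = hi i - lo i" "{lo i..hi i} \<subseteq> \<gamma> (fst i)"
          using uv le by (auto simp: lo_def hi_def xK)
      qed
      define t where "t i = measure lborel (snd i) * g' (fst i) - (F (hi i) - F (lo i))" for i
      have tele: "(\<Sum>i\<in>p. H (hi i) - H (lo i)) = H b - H a" for H :: "real \<Rightarrow> real"
        using additive_tagged_division_1[OF ab p, of H] by (simp add: lo_def hi_def split_beta)
      have regular: "\<bar>t i\<bar> \<le> e1 * (hi i - lo i)" if i: "i \<in> p" "fst i \<notin> N" for i
      proof -
        let ?x = "fst i"
        have x: "?x \<in> {a..b} - N" using K[OF i(1)] i(2) by auto
        have "lo i \<in> \<gamma> ?x" "hi i \<in> \<gamma> ?x" using K[OF i(1)] by auto
        then have "\<bar>lo i - ?x\<bar> < r ?x" "\<bar>hi i - ?x\<bar> < r ?x"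
          using x by (auto simp: \<gamma>_def dist_real_def abs_minus_commute split: if_splits)
        then have "\<bar>F (lo i) - F ?x - g ?x * (lo i - ?x)\<bar> \<le> e1 * (?x - lo i)"
          "\<bar>F (hi i) - F ?x - g ?x * (hi i - ?x)\<bar> \<le> e1 * (hi i - ?x)"
          using r(2)[OF x] K[OF i(1)] by (metis abs_minus_commute abs_of_nonneg diff_ge_0_iff_ge)+
        moreover have "t i = (F (lo i) - F ?x - g ?x * (lo i - ?x)) - (F (hi i) - F ?x - g ?x * (hi i - ?x))"
          unfolding t_def g'_def K(6)[OF i(1)] using i(2) by (simp add: algebra_simps)
        moreover have "e1 * (?x - lo i) + e1 * (hi i - ?x) = e1 * (hi i - lo i)"
          by (simp add: algebra_simps)
        ultimately show ?thesis by linarith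
      qed
      \<comment> \<open>Degenerate intervals tagged in N contribute nothing and are left out of both parts.\<close>
      define p1 where "p1 = {i \<in> p. fst i \<notin> N}"
      define p2 where "p2 = {i \<in> p. fst i \<in> N \<and> lo i < hi i}"
      have fin12: "finite p1" "finite p2" using fin by (auto simp: p1_def p2_def)
      have int: "interior (snd i) = {lo i<..<hi i}" if "i \<in> p" for i
        unfolding K(1)[OF that] by simp
      have disj: "disjoint_family_on (\<lambda>i. {lo i<..<hi i}) p"
        unfolding disjoint_family_on_def
      proof (intro ballI impI)
        fix i j assume ij: "i \<in> p" "j \<in> p" "i \<noteq> j"
        then have "interior (snd i) \<inter> interior (snd j) = {}"
          using tagged_division_ofD(5)[OF p, of "fst i" "snd i" "fst j" "snd j"] by simp
        then show "{lo i<..<hi i} \<inter> {lo j<..<hi j} = {}" using int ij by simp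
      qed
      have disj2: "disjoint_family_on (\<lambda>i. {lo i<..<hi i}) p2"
        by (rule disjoint_family_on_mono[OF _ disj]) (auto simp: p2_def)
      have "(\<Sum>i\<in>p2. hi i - lo i) = (\<Sum>i\<in>p2. measure lebesgue {lo i<..<hi i})"
        by (rule sum.cong) (auto simp: p2_def)
      also have "\<dots> = measure lebesgue (\<Union>i\<in>p2. {lo i<..<hi i})"
        by (rule measure_finite_Union[symmetric]) (use fin12 disj2 in \<open>auto simp: p2_def\<close>)
      also have "\<dots> \<le> measure lebesgue G"
      proof (rule measure_mono_fmeasurable[OF _ _ G(3)])
        show "(\<Union>i\<in>p2. {lo i<..<hi i}) \<subseteq> G"
        proof
          fix y assume "y \<in> (\<Union>i\<in>p2. {lo i<..<hi i})"
          then obtain i where i: "i \<in> p" "fst i \<in> N" "y \<in> {lo i<..<hi i}" by (auto simp: p2_def)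
          have "y \<in> {lo i..hi i}" using i(3) by auto
          then have "y \<in> \<gamma> (fst i)" using K(7)[OF i(1)] by blast
          then show "y \<in> G" using i(2) by (simp add: \<gamma>_def)
        qed
        show "(\<Union>i\<in>p2. {lo i<..<hi i}) \<in> sets lebesgue"
          by (rule sets.finite_UN[OF fin12(2)]) simp
      qed
      finally have len: "(\<Sum>i\<in>p2. hi i - lo i) < \<delta>" using G(4) by simp
      have exc: "(\<Sum>i\<in>p2. \<bar>F (hi i) - F (lo i)\<bar>) < e / 2"
      proof -
        have "disjoint_subintervals a b p2 lo hi"
          unfolding disjoint_subintervals_def
        proof (intro conjI ballI)
          fix i assume "i \<in> p2"
          then have i: "i \<in> p" "lo i < hi i" by (auto simp: p2_def)
          show "a \<le> lo i" "lo i < hi i" "hi i \<le> b" using K(4,5)[OF i(1)] i(2) by auto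
        qed (rule fin12 disj2)+
        then show ?thesis using len by (rule \<delta>_small)
      qed
      have "sum (\<lambda>(x, K). measure lborel K *\<^sub>R g' x) p - (F b - F a) = (\<Sum>i\<in>p. t i)"
        unfolding tele[of F, symmetric] t_def by (simp add: sum_subtractf split_beta)
      also have "\<dots> = (\<Sum>i\<in>p1 \<union> p2. t i)"
      proof (rule sum.mono_neutral_right[OF fin])
        show "p1 \<union> p2 \<subseteq> p" by (auto simp: p1_def p2_def)
        show "\<forall>i\<in>p - (p1 \<union> p2). t i = 0"
        proof
          fix i assume "i \<in> p - (p1 \<union> p2)"
          then have i: "i \<in> p" "fst i \<in> N" "\<not> lo i < hi i" by (auto simp: p1_def p2_def)
          then have "lo i = hi i" using K[OF i(1)] by linarith
          then show "t i = 0" using i(2) by (simp add: t_def g'_def)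
        qed
      qed
      also have "\<dots> = (\<Sum>i\<in>p1. t i) + (\<Sum>i\<in>p2. t i)"
        using fin12 by (intro sum.union_disjoint) (auto simp: p1_def p2_def)
      finally have eq: "sum (\<lambda>(x, K). measure lborel K *\<^sub>R g' x) p - (F b - F a) = \<dots>" .
      have "\<bar>\<Sum>i\<in>p1. t i\<bar> \<le> (\<Sum>i\<in>p1. e1 * (hi i - lo i))"
        by (rule order_trans[OF sum_abs sum_mono]) (auto simp: p1_def intro: regular)
      also have "\<dots> \<le> (\<Sum>i\<in>p. e1 * (hi i - lo i))"
      proof (rule sum_mono2[OF fin])
        fix i assume "i \<in> p - p1"
        then have "lo i \<le> hi i" using K(2,3)[of i] by auto
        then show "0 \<le> e1 * (hi i - lo i)" using e1(1) by simp
      qed (auto simp: p1_def)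
      also have "\<dots> = e1 * (b - a)" using tele[of "\<lambda>x. x"] by (simp add: sum_distrib_left[symmetric])
      finally have 1: "\<bar>\<Sum>i\<in>p1. t i\<bar> < e / 2" using e1 by simp
      have "\<bar>\<Sum>i\<in>p2. t i\<bar> \<le> (\<Sum>i\<in>p2. \<bar>F (hi i) - F (lo i)\<bar>)"
        by (rule order_trans[OF sum_abs sum_mono]) (auto simp: p2_def t_def g'_def)
      with exc have 2: "\<bar>\<Sum>i\<in>p2. t i\<bar> < e / 2" by simp
      show ?thesis unfolding eq real_norm_def using 1 2 by linarith
    qed
    show "\<exists>\<gamma>. gauge \<gamma> \<and> (\<forall>p. p tagged_division_of {a..b} \<and> \<gamma> fine p \<longrightarrow>
        norm (sum (\<lambda>(x, K). measure lborel K *\<^sub>R g' x) p - (F b - F a)) < e)"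
      by (rule exI[of _ \<gamma>]) (intro conjI gauge allI impI, elim conjE, rule riemann_sum)
  qed
  then show ?thesis by (rule has_integral_spike[OF N, rotated]) (simp add: g'_def)
qed

lemma lipschitz_imp_abs_continuous_on_interval:
  fixes f :: "real \<Rightarrow> real"
  assumes f: "\<And>x y. \<lbrakk>x \<in> {a..b}; y \<in> {a..b}\<rbrakk> \<Longrightarrow> \<bar>f y - f x\<bar> \<le> C * \<bar>y - x\<bar>" and C: "C \<ge> 0"
  shows "abs_continuous_on_interval f a b"
  unfolding abs_continuous_on_interval_def
proof (intro allI impI)
  fix \<epsilon> :: real assume \<epsilon>: "\<epsilon> > 0"
  show "\<exists>\<delta>>0. \<forall>(n::nat) u v. (\<forall>i<n. a \<le> u i \<and> u i < v i \<and> v i \<le> b) \<longrightarrow>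
      disjoint_family_on (\<lambda>i. {u i<..<v i}) {..<n} \<longrightarrow>
      (\<Sum>i<n. v i - u i) < \<delta> \<longrightarrow> (\<Sum>i<n. \<bar>f (v i) - f (u i)\<bar>) < \<epsilon>"
  proof (rule exI[of _ "\<epsilon> / (C + 1)"], intro conjI allI impI)
    show "0 < \<epsilon> / (C + 1)" using \<epsilon> C by simp
    fix n :: nat and u v
    assume uv: "\<forall>i<n. a \<le> u i \<and> u i < v i \<and> v i \<le> b" and len: "(\<Sum>i<n. v i - u i) < \<epsilon> / (C + 1)"
    have 0: "0 \<le> (\<Sum>i<n. v i - u i)" using uv by (intro sum_nonneg) fastforce
    have "(\<Sum>i<n. \<bar>f (v i) - f (u i)\<bar>) \<le> (\<Sum>i<n. C * (v i - u i))"
    proof (rule sum_mono)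
      fix i assume "i \<in> {..<n}"
      then have "a \<le> u i" "u i < v i" "v i \<le> b" using uv by auto
      then show "\<bar>f (v i) - f (u i)\<bar> \<le> C * (v i - u i)" using f[of "u i" "v i"] by simp
    qed
    also have "\<dots> = C * (\<Sum>i<n. v i - u i)" by (simp add: sum_distrib_left)
    also have "\<dots> \<le> (C + 1) * (\<Sum>i<n. v i - u i)" using 0 by (simp add: algebra_simps)
    also have "\<dots> < \<epsilon>" using len C by (simp add: field_simps)
    finally show "(\<Sum>i<n. \<bar>f (v i) - f (u i)\<bar>) < \<epsilon>" .
  qed
qed

lemma has_field_derivative_deriv0: "f differentiable (at x) \<Longrightarrow> (f has_field_derivative deriv0 f x) (at x)"
  unfolding deriv0_def
  by (simp add: DERIV_deriv_iff_real_differentiable)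

text \<open>
  The bound on \<open>deriv0 f\<close> controls \<open>f\<close> only through the integral of the derivative, that is through
  the fundamental theorem for absolutely continuous functions.
\<close>

lemma abs_continuous_bounded_deriv_lipschitz:
  assumes f: "abs_continuous f" and C: "\<And>x. \<bar>deriv0 f x\<bar> \<le> C"
  shows "\<bar>f y - f x\<bar> \<le> C * \<bar>y - x\<bar>"
proof -
  have le: "\<bar>f y - f x\<bar> \<le> C * \<bar>y - x\<bar>" if "x \<le> y" for x y
  proof -
    have "(deriv0 f has_integral f y - f x) {x..y}"
      by (rule abs_continuous_FTC[OF _ that abs_continuous_differentiable_ae[OF f]])
        (use f that in \<open>auto simp: abs_continuous_def intro: has_field_derivative_deriv0\<close>)
    moreover have "0 \<le> C" using C[of 0] by simp
    ultimately have "norm (f y - f x) \<le> C * measure lborel {x..y}"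
      by (intro has_integral_bound_real[of C "{}" "deriv0 f"]) (use C in auto)
    then show ?thesis using that by simp
  qed
  show ?thesis
  proof (cases "x \<le> y")
    case False
    then show ?thesis using le[of y x] by (simp add: abs_minus_commute)
  qed (rule le)
qed

section \<open>Borel measurability of the derivative\<close>

text \<open>
  A Cauchy condition describes differentiability without mentioning the value of the derivative;
  for fixed increments it is a closed condition on \<open>x\<close> when \<open>f\<close> is continuous.
\<close>

lemma Cauchy_quotients_imp_differentiable:
  fixes f :: "real \<Rightarrow> real"
  assumes cauchy: "\<And>n::nat. \<exists>m::nat. \<forall>h k. h \<noteq> 0 \<and> k \<noteq> 0 \<and> \<bar>h\<bar> < 1 / real (Suc m) \<and> \<bar>k\<bar> < 1 / real (Suc m) \<longrightarrow>
      \<bar>(f (x + h) - f x) / h - (f (x + k) - f x) / k\<bar> \<le> 1 / real (Suc n)"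
  shows "f differentiable (at x)"
proof -
  define q where "q h = (f (x + h) - f x) / h" for h
  define s where "s j = q (1 / real (Suc j))" for j
  have C: "\<exists>m::nat. \<forall>h k. h \<noteq> 0 \<and> k \<noteq> 0 \<and> \<bar>h\<bar> < 1 / real (Suc m) \<and> \<bar>k\<bar> < 1 / real (Suc m) \<longrightarrow>
      \<bar>q h - q k\<bar> < e" if "e > 0" for e
  proof -
    obtain n :: nat where n: "1 / real (Suc n) < e" using \<open>e > 0\<close> nat_approx_posE by blast
    from cauchy[of n] obtain m where m: "\<forall>h k. h \<noteq> 0 \<and> k \<noteq> 0 \<and> \<bar>h\<bar> < 1 / real (Suc m) \<and> \<bar>k\<bar> < 1 / real (Suc m) \<longrightarrow>
      \<bar>q h - q k\<bar> \<le> 1 / real (Suc n)" unfolding q_def ..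
    show ?thesis
      by (intro exI[of _ m] allI impI, rule le_less_trans[OF _ n], rule m[rule_format])
  qed
  have small: "\<bar>1 / real (Suc j)\<bar> < 1 / real (Suc m)" if "j > m" for j m
  proof -
    have "1 / real (Suc j) < 1 / real (Suc m)" by (rule divide_strict_left_mono) (use that in auto)
    then show ?thesis by simp
  qed
  have "Cauchy s"
  proof (rule metric_CauchyI)
    fix e :: real assume "e > 0"
    from C[OF this] obtain m where m: "\<forall>h k. h \<noteq> 0 \<and> k \<noteq> 0 \<and> \<bar>h\<bar> < 1 / real (Suc m) \<and> \<bar>k\<bar> < 1 / real (Suc m) \<longrightarrow>
      \<bar>q h - q k\<bar> < e" ..
    have "dist (s i) (s j) < e" if "i \<ge> Suc m" "j \<ge> Suc m" for i j
      unfolding s_def dist_real_def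
      by (rule m[rule_format]) (use small[of m i] small[of m j] that in auto)
    then show "\<exists>M. \<forall>i\<ge>M. \<forall>j\<ge>M. dist (s i) (s j) < e" by blast
  qed
  then obtain L where L: "s \<longlonglongrightarrow> L" using Cauchy_convergent convergent_def by blast
  have "q \<midarrow>0\<rightarrow> L"
  proof (rule LIM_I)
    fix e :: real assume e: "e > 0"
    from C[OF half_gt_zero[OF e]] obtain m where
      m: "\<forall>h k. h \<noteq> 0 \<and> k \<noteq> 0 \<and> \<bar>h\<bar> < 1 / real (Suc m) \<and> \<bar>k\<bar> < 1 / real (Suc m) \<longrightarrow>
      \<bar>q h - q k\<bar> < e / 2" ..
    have "norm (q h - L) < e" if h: "h \<noteq> 0" "\<bar>h\<bar> < 1 / real (Suc m)" for h
    proof -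
      have "(\<lambda>j. \<bar>q h - s j\<bar>) \<longlonglongrightarrow> \<bar>q h - L\<bar>" by (intro tendsto_intros L)
      moreover have "\<bar>q h - s j\<bar> \<le> e / 2" if "j \<ge> Suc m" for j
        unfolding s_def by (rule less_imp_le, rule m[rule_format]) (use small[of m j] that h in auto)
      ultimately have "\<bar>q h - L\<bar> \<le> e / 2" by (intro LIMSEQ_le_const2) auto
      then show ?thesis using e by simp
    qed
    then show "\<exists>d>0. \<forall>h. h \<noteq> 0 \<and> norm (h - 0) < d \<longrightarrow> norm (q h - L) < e"
      by (intro exI[of _ "1 / real (Suc m)"]) auto
  qed
  then have "(f has_field_derivative L) (at x)" by (simp add: DERIV_def q_def[abs_def])
  then show ?thesis by (auto simp: real_differentiable_def)
qed

lemma differentiable_imp_Cauchy_quotients: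
  fixes f :: "real \<Rightarrow> real"
  assumes "f differentiable (at x)"
  shows "\<exists>m::nat. \<forall>h k. h \<noteq> 0 \<and> k \<noteq> 0 \<and> \<bar>h\<bar> < 1 / real (Suc m) \<and> \<bar>k\<bar> < 1 / real (Suc m) \<longrightarrow>
      \<bar>(f (x + h) - f x) / h - (f (x + k) - f x) / k\<bar> \<le> 1 / real (Suc n)"
proof -
  obtain D where D: "(\<lambda>h. (f (x + h) - f x) / h) \<midarrow>0\<rightarrow> D"
    using assms by (auto simp: real_differentiable_def DERIV_def)
  define e where "e = 1 / real (Suc n) / 2"
  have "e > 0" by (simp add: e_def)
  from LIM_D[OF D this] obtain d where d: "d > 0" "\<And>h. \<lbrakk>h \<noteq> 0; \<bar>h\<bar> < d\<rbrakk> \<Longrightarrow>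
      \<bar>(f (x + h) - f x) / h - D\<bar> < e" by auto
  obtain m :: nat where m: "1 / real (Suc m) < d" using d(1) nat_approx_posE by blast
  show ?thesis
  proof (intro exI[of _ m] allI impI)
    fix h k assume "h \<noteq> 0 \<and> k \<noteq> 0 \<and> \<bar>h\<bar> < 1 / real (Suc m) \<and> \<bar>k\<bar> < 1 / real (Suc m)"
    then have "\<bar>(f (x + h) - f x) / h - D\<bar> < e" "\<bar>(f (x + k) - f x) / k - D\<bar> < e"
      using d(2)[of h] d(2)[of k] m by linarith+
    moreover have "1 / real (Suc n) = e + e" by (simp only: e_def field_sum_of_halves)
    ultimately show "\<bar>(f (x + h) - f x) / h - (f (x + k) - f x) / k\<bar> \<le> 1 / real (Suc n)" by linarith
  qed
qed

text \<open>
  The set has the form of a countable intersection of countable unions of closed sets. The innermost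
  intersection, over all pairs of increments, is uncountable, but intersections of closed sets are closed.
\<close>

lemma borel_differentiability_points:
  fixes f :: "real \<Rightarrow> real"
  assumes f: "continuous_on UNIV f"
  shows "{x. f differentiable (at x)} \<in> sets borel"
proof -
  define R where "R m = {(h, k). h \<noteq> 0 \<and> k \<noteq> 0 \<and> \<bar>h\<bar> < 1 / real (Suc m) \<and> \<bar>k\<bar> < 1 / real (Suc m)}" for m :: nat
  define S where "S n m = (\<Inter>(h, k)\<in>R m. {x. \<bar>(f (x + h) - f x) / h - (f (x + k) - f x) / k\<bar> \<le> 1 / real (Suc n)})"
    for n m :: nat
  have "closed (S n m)" for n m
    unfolding S_def
  proof (intro closed_INT ballI, clarify)
    fix h k assume "(h, k) \<in> R m"
    then have "h \<noteq> 0" "k \<noteq> 0" by (auto simp: R_def)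
    then show "closed {x. \<bar>(f (x + h) - f x) / h - (f (x + k) - f x) / k\<bar> \<le> 1 / real (Suc n)}"
      by (intro closed_Collect_le continuous_intros continuous_on_compose2[OF f]) auto
  qed
  then have "(\<Inter>n. \<Union>m. S n m) \<in> sets borel" by (intro sets.countable_INT' sets.countable_UN) auto
  moreover have "{x. f differentiable (at x)} = (\<Inter>n. \<Union>m. S n m)"
  proof -
    have "f differentiable (at x) \<longleftrightarrow> (\<forall>n. \<exists>m. x \<in> S n m)" for x
    proof
      assume "f differentiable (at x)"
      from differentiable_imp_Cauchy_quotients[OF this] show "\<forall>n. \<exists>m. x \<in> S n m"
        by (auto simp: S_def R_def)
    next
      assume a: "\<forall>n. \<exists>m. x \<in> S n m"
      show "f differentiable (at x)"
      proof (rule Cauchy_quotients_imp_differentiable)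
        fix n
        from a obtain m where "x \<in> S n m" by blast
        then show "\<exists>m::nat. \<forall>h k. h \<noteq> 0 \<and> k \<noteq> 0 \<and> \<bar>h\<bar> < 1 / real (Suc m) \<and> \<bar>k\<bar> < 1 / real (Suc m) \<longrightarrow>
      \<bar>(f (x + h) - f x) / h - (f (x + k) - f x) / k\<bar> \<le> 1 / real (Suc n)"
          by (intro exI[of _ m]) (auto simp: S_def R_def)
      qed
    qed
    then show ?thesis by auto
  qed
  ultimately show ?thesis by simp
qed

lemma borel_measurable_deriv0:
  assumes f: "continuous_on UNIV f"
  shows "deriv0 f \<in> borel_measurable borel"
proof (rule borel_measurable_LIMSEQ_real)
  let ?g = "\<lambda>j x. if x \<in> {x. f differentiable (at x)}
    then (f (x + 1 / real (Suc j)) - f x) / (1 / real (Suc j)) else 0"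
  show "?g j \<in> borel_measurable borel" for j
  proof (rule measurable_If_set)
    show "(\<lambda>x. (f (x + 1 / real (Suc j)) - f x) / (1 / real (Suc j))) \<in> borel_measurable borel"
      by (intro borel_measurable_continuous_onI continuous_intros continuous_on_compose2[OF f]) auto
    show "{x. f differentiable (at x)} \<inter> space borel \<in> sets borel"
      using borel_differentiability_points[OF f] by simp
  qed simp
  show "(\<lambda>j. ?g j x) \<longlonglongrightarrow> deriv0 f x" for x
  proof (cases "f differentiable (at x)")
    case True
    have "(\<lambda>h. (f (x + h) - f x) / h) \<midarrow>0\<rightarrow> deriv0 f x"
      using has_field_derivative_deriv0[OF True] by (simp add: DERIV_def)
    moreover have "filterlim (\<lambda>j. 1 / real (Suc j)) (at 0) sequentially"
      unfolding filterlim_at using LIMSEQ_inverse_real_of_nat by (auto simp: inverse_eq_divide)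
    ultimately have "(\<lambda>j. (f (x + 1 / real (Suc j)) - f x) / (1 / real (Suc j))) \<longlonglongrightarrow> deriv0 f x"
      by (rule filterlim_compose)
    then show ?thesis using True by simp
  qed (simp add: deriv0_def)
qed

section \<open>Stein's identity for the standard normal distribution\<close>

lemma one_le_sqrt_2pi: "1 \<le> sqrt (2 * pi)"
  by (rule real_le_rsqrt) (use pi_ge_two in simp)

lemma std_normal_density_le_1: "std_normal_density x \<le> 1"
proof -
  have "exp (- x\<^sup>2 / 2) \<le> 1 * sqrt (2 * pi)"
    by (rule order_trans[of _ 1]) (use one_le_sqrt_2pi in simp_all)
  then show ?thesis using one_le_sqrt_2pi by (simp add: std_normal_density_def divide_le_eq)
qed

lemma std_normal_density_le_inverse_square:
  assumes "x \<noteq> 0" shows "std_normal_density x \<le> 2 / x\<^sup>2"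
proof -
  have "1 + x\<^sup>2 / 2 \<le> exp (x\<^sup>2 / 2)" by (rule exp_ge_add_one_self)
  then have "x\<^sup>2 / 2 \<le> exp (x\<^sup>2 / 2)" by linarith
  then have "exp (- (x\<^sup>2 / 2)) \<le> inverse (x\<^sup>2 / 2)"
    unfolding exp_minus by (rule le_imp_inverse_le) (use assms in simp)
  also have "\<dots> = 2 / x\<^sup>2" by simp
  finally have "exp (- x\<^sup>2 / 2) \<le> 2 / x\<^sup>2" by simp
  moreover have "1 / sqrt (2 * pi) \<le> 1" using one_le_sqrt_2pi by (simp add: divide_le_eq)
  ultimately have "1 / sqrt (2 * pi) * exp (- x\<^sup>2 / 2) \<le> 1 * (2 / x\<^sup>2)"
    by (intro mult_mono) auto
  then show ?thesis by (simp add: std_normal_density_def)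
qed

lemma std_normal_density_deriv:
  "(std_normal_density has_field_derivative - x * std_normal_density x) (at x within S)"
  unfolding std_normal_density_def[abs_def]
  by (auto intro!: derivative_eq_intros simp: field_simps)

lemma continuous_on_if_lipschitz:
  fixes f :: "real \<Rightarrow> real"
  assumes "\<And>x y. \<bar>f y - f x\<bar> \<le> C * \<bar>y - x\<bar>"
  shows "continuous_on UNIV f"
proof -
  have "0 \<le> C" using assms[of 1 0] by (simp add: abs_ge_zero[THEN order_trans])
  then have "C-lipschitz_on UNIV f"
    using assms by (intro lipschitz_onI) (auto simp: dist_real_def)
  then show ?thesis by (rule lipschitz_on_continuous_on)
qed

text \<open>
  On a bounded interval both factors are bounded and Lipschitz. The density has Lipschitz constant
  \<open>n\<close> there, because its derivative is \<open>- x\<close> times the density, which is at most 1.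
\<close>

lemma std_normal_stein_product_abs_continuous:
  assumes lip: "\<And>x y. \<bar>f y - f x\<bar> \<le> C * \<bar>y - x\<bar>" and "n \<ge> 0"
  shows "abs_continuous_on_interval (\<lambda>x. std_normal_density x * f x) (- n) n"
proof (rule lipschitz_imp_abs_continuous_on_interval)
  have C: "0 \<le> C" using lip[of 1 0] by (simp add: abs_ge_zero[THEN order_trans])
  show "0 \<le> n * (\<bar>f 0\<bar> + C * n) + C" using C \<open>n \<ge> 0\<close> by simp
  fix x y assume xy: "x \<in> {-n..n}" "y \<in> {-n..n}"
  let ?p = std_normal_density
  have p: "\<bar>?p y - ?p x\<bar> \<le> n * \<bar>y - x\<bar>"
  proof -
    have "norm (?p y - ?p x) \<le> n * norm (y - x)"
    proof (rule field_differentiable_bound[of "{-n..n}" _ "\<lambda>x. - x * ?p x"])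
      show "(?p has_field_derivative - z * ?p z) (at z within {-n..n})" for z
        by (rule std_normal_density_deriv)
      fix z assume z: "z \<in> {-n..n}"
      have "\<bar>z\<bar> * ?p z \<le> n * 1"
        using z std_normal_density_le_1[of z] by (intro mult_mono) auto
      then show "norm (- z * ?p z) \<le> n" by (simp add: abs_mult)
    qed (use xy in auto)
    then show ?thesis by simp
  qed
  have "\<bar>f y\<bar> \<le> \<bar>f 0\<bar> + C * \<bar>y\<bar>" using lip[of y 0] by (simp add: abs_le_iff) linarith
  also have "\<dots> \<le> \<bar>f 0\<bar> + C * n" using xy C by (intro add_left_mono mult_left_mono) auto
  finally have fy: "\<bar>f y\<bar> \<le> \<bar>f 0\<bar> + C * n" .
  have "?p y * f y - ?p x * f x = (?p y - ?p x) * f y + ?p x * (f y - f x)" by (simp add: algebra_simps)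
  then have "\<bar>?p y * f y - ?p x * f x\<bar> \<le> \<bar>(?p y - ?p x) * f y\<bar> + \<bar>?p x * (f y - f x)\<bar>"
    by (simp only: abs_triangle_ineq)
  also have "\<dots> = \<bar>?p y - ?p x\<bar> * \<bar>f y\<bar> + ?p x * \<bar>f y - f x\<bar>"
    by (simp add: abs_mult)
  also have "\<dots> \<le> (n * \<bar>y - x\<bar>) * (\<bar>f 0\<bar> + C * n) + 1 * (C * \<bar>y - x\<bar>)"
    using p fy lip[of y x] std_normal_density_le_1[of x] \<open>n \<ge> 0\<close>
    by (intro add_mono mult_mono) auto
  finally show "\<bar>?p y * f y - ?p x * f x\<bar> \<le> (n * (\<bar>f 0\<bar> + C * n) + C) * \<bar>y - x\<bar>"
    by (simp add: algebra_simps)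
qed

text \<open>
  The function \<open>F = p * f\<close>, with \<open>p\<close> the Gaussian density, is absolutely continuous and has derivative \<open>g x = p x * deriv0 f x - p x * (x * f x)\<close>
  almost everywhere, so the integral of \<open>g\<close> over \<open>{- n..n}\<close> is \<open>F n - F (- n)\<close>. As \<open>n\<close> grows, the former
  tends to the integral over the line by dominated convergence, and the latter vanishes because \<open>f\<close>
  grows at most linearly.
\<close>

theorem std_normal_stein_identity:
  assumes f: "abs_continuous f" and C: "\<And>x. \<bar>deriv0 f x\<bar> \<le> C"
  shows "(\<integral>x. deriv0 f x \<partial>std_normal_distribution) = (\<integral>x. x * f x \<partial>std_normal_distribution)"
proof -
  let ?p = std_normal_density
  note lip = abs_continuous_bounded_deriv_lipschitz[OF f C]
  have C0: "0 \<le> C" using C[of 0] by simp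
  have growth: "\<bar>f x\<bar> \<le> \<bar>f 0\<bar> + C * \<bar>x\<bar>" for x
    using lip[of x 0] by (simp add: abs_le_iff) linarith
  have cont: "continuous_on UNIV f" using lip by (rule continuous_on_if_lipschitz)
  have meas[measurable]: "f \<in> borel_measurable borel" "deriv0 f \<in> borel_measurable borel"
    using cont by (auto intro: borel_measurable_continuous_onI borel_measurable_deriv0)
  have int_deriv: "integrable lborel (\<lambda>x. ?p x * deriv0 f x)"
  proof (rule Bochner_Integration.integrable_bound)
    show "integrable lborel (\<lambda>x. C * ?p x)" by simp
    show "AE x in lborel. norm (?p x * deriv0 f x) \<le> norm (C * ?p x)"
      using C C0 by (intro AE_I2) (simp add: abs_mult mult.commute[of C] mult_left_mono)
  qed measurable
  have int_f: "integrable lborel (\<lambda>x. ?p x * (x * f x))"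
  proof (rule Bochner_Integration.integrable_bound)
    show "integrable lborel (\<lambda>x. \<bar>f 0\<bar> * (?p x * \<bar>x\<bar> ^ 1) + C * (?p x * \<bar>x\<bar> ^ 2))"
      by (intro Bochner_Integration.integrable_add integrable_mult_right integrable_std_normal_moment_abs)
    have "norm (?p x * (x * f x)) \<le> norm (\<bar>f 0\<bar> * (?p x * \<bar>x\<bar> ^ 1) + C * (?p x * \<bar>x\<bar> ^ 2))" for x
    proof -
      have "norm (?p x * (x * f x)) = ?p x * \<bar>x\<bar> * \<bar>f x\<bar>" by (simp add: abs_mult)
      also have "\<dots> \<le> ?p x * \<bar>x\<bar> * (\<bar>f 0\<bar> + C * \<bar>x\<bar>)"
        using growth by (intro mult_left_mono) auto
      also have "\<dots> = \<bar>f 0\<bar> * (?p x * \<bar>x\<bar> ^ 1) + C * (?p x * \<bar>x\<bar> ^ 2)"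
        by (simp add: algebra_simps power2_eq_square)
      also have "\<dots> \<le> norm \<dots>" by simp
      finally show ?thesis .
    qed
    then show "AE x in lborel. norm (?p x * (x * f x)) \<le>
        norm (\<bar>f 0\<bar> * (?p x * \<bar>x\<bar> ^ 1) + C * (?p x * \<bar>x\<bar> ^ 2))" by simp
  qed measurable
  define g where "g x = ?p x * deriv0 f x - ?p x * (x * f x)" for x
  define F where "F x = ?p x * f x" for x
  have int_g: "integrable lborel g"
    unfolding g_def by (intro Bochner_Integration.integrable_diff int_deriv int_f)
  have by_parts: "(LINT x:{- n..n}|lborel. g x) = F n - F (- n)" if n: "n \<ge> 0" for n
  proof -
    have "(g has_integral F n - F (- n)) {- n..n}"
    proof (rule abs_continuous_FTC[OF _ _ abs_continuous_differentiable_ae[OF f]])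
      show "abs_continuous_on_interval F (- n) n"
        unfolding F_def using lip n by (rule std_normal_stein_product_abs_continuous)
      fix x assume "x \<in> {- n..n} - {x. \<not> f differentiable at x}"
      then have "(f has_field_derivative deriv0 f x) (at x)" by (intro has_field_derivative_deriv0) simp
      from DERIV_mult[OF std_normal_density_deriv[of x UNIV] this]
      show "(F has_field_derivative g x) (at x)"
        by (simp add: F_def[abs_def] g_def algebra_simps)
    qed (use n in simp)
    moreover have "set_integrable lborel {- n..n} g"
      unfolding set_integrable_def by (intro integrable_mult_indicator int_g) simp
    ultimately show ?thesis using set_borel_integral_eq_integral(2) by (metis integral_unique)
  qed
  have "(\<lambda>n. LINT x:{- real n..real n}|lborel. g x) \<longlonglongrightarrow> (LINT x|lborel. g x)"
    unfolding set_lebesgue_integral_def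
  proof (rule integral_dominated_convergence[where w = "\<lambda>x. \<bar>g x\<bar>"])
    show "AE x in lborel. (\<lambda>n. indicat_real {- real n..real n} x *\<^sub>R g x) \<longlonglongrightarrow> g x"
    proof (intro AE_I2)
      fix x :: real
      obtain N :: nat where N: "\<bar>x\<bar> \<le> real N" using real_arch_simple by blast
      have "\<forall>\<^sub>F n in sequentially. indicat_real {- real n..real n} x *\<^sub>R g x = g x"
        using eventually_ge_at_top[of N]
      proof eventually_elim
        case (elim n)
        then have "real N \<le> real n" by simp
        with N have "x \<in> {- real n..real n}" by auto
        then show ?case by simp
      qed
      then show "(\<lambda>n. indicat_real {- real n..real n} x *\<^sub>R g x) \<longlonglongrightarrow> g x" by (rule tendsto_eventually)
    qed
  qed (use int_g in \<open>auto simp: indicator_def\<close>)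
  then have lim: "(\<lambda>n. F (real n) - F (- real n)) \<longlonglongrightarrow> (LINT x|lborel. g x)" by (simp add: by_parts)
  have decay: "\<bar>F x\<bar> \<le> 2 * (\<bar>f 0\<bar> + C) / \<bar>x\<bar>" if "\<bar>x\<bar> \<ge> 1" for x
  proof -
    have "\<bar>F x\<bar> = ?p x * \<bar>f x\<bar>" by (simp add: F_def abs_mult)
    also have "\<dots> \<le> (2 / x\<^sup>2) * ((\<bar>f 0\<bar> + C) * \<bar>x\<bar>)"
    proof (rule mult_mono)
      show "?p x \<le> 2 / x\<^sup>2" using that by (intro std_normal_density_le_inverse_square) auto
      have "\<bar>f 0\<bar> * 1 \<le> \<bar>f 0\<bar> * \<bar>x\<bar>" using that by (intro mult_left_mono) auto
      with growth[of x] show "\<bar>f x\<bar> \<le> (\<bar>f 0\<bar> + C) * \<bar>x\<bar>" by (simp add: algebra_simps)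
    qed auto
    also have "\<dots> = 2 * (\<bar>f 0\<bar> + C) * (\<bar>x\<bar> / x\<^sup>2)" by simp
    also have "\<bar>x\<bar> / x\<^sup>2 = 1 / \<bar>x\<bar>"
    proof -
      have "x\<^sup>2 = \<bar>x\<bar> * \<bar>x\<bar>" by (simp add: power2_eq_square)
      with that show ?thesis by (simp del: abs_mult_self_eq)
    qed
    finally show ?thesis by simp
  qed
  have vanish: "(\<lambda>n. F (real n) - F (- real n)) \<longlonglongrightarrow> 0"
  proof (rule Lim_null_comparison)
    show "\<forall>\<^sub>F n in sequentially. norm (F (real n) - F (- real n)) \<le> 4 * (\<bar>f 0\<bar> + C) * (1 / real n)"
      using eventually_ge_at_top[of 1]
    proof eventually_elim
      case (elim n)
      then have "\<bar>F (real n)\<bar> \<le> 2 * (\<bar>f 0\<bar> + C) / real n" "\<bar>F (- real n)\<bar> \<le> 2 * (\<bar>f 0\<bar> + C) / real n"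
        using decay[of "real n"] decay[of "- real n"] by auto
      then have "\<bar>F (real n) - F (- real n)\<bar> \<le> 2 * (\<bar>f 0\<bar> + C) / real n + 2 * (\<bar>f 0\<bar> + C) / real n"
        by linarith
      then show ?case by (simp add: field_simps)
    qed
    show "(\<lambda>n. 4 * (\<bar>f 0\<bar> + C) * (1 / real n)) \<longlonglongrightarrow> 0"
      by (intro tendsto_mult_right_zero lim_1_over_n)
  qed
  have "(LINT x|lborel. g x) = 0" using lim vanish by (rule LIMSEQ_unique)
  then have "(LINT x|lborel. ?p x * deriv0 f x) = (LINT x|lborel. ?p x * (x * f x))"
    unfolding g_def using int_deriv int_f by simp
  then show ?thesis by (simp add: integral_density)
qed

lemma bounded_derivative_imp_stein_test_function:
  fixes f :: "real \<Rightarrow> real"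
  assumes f: "\<And>x. (f has_field_derivative f' x) (at x)" and C: "\<And>x. \<bar>f' x\<bar> \<le> C"
  shows "abs_continuous f" "deriv0 f = f'" "bounded (range (deriv0 f))"
proof -
  have "\<bar>f y - f x\<bar> \<le> C * \<bar>y - x\<bar>" for x y
    using field_differentiable_bound[of UNIV f f' C y x] f C by simp
  moreover have "0 \<le> C" using C[of 0] by simp
  ultimately show "abs_continuous f"
    unfolding abs_continuous_def by (blast intro: lipschitz_imp_abs_continuous_on_interval)
  show eq: "deriv0 f = f'"
  proof
    fix x
    have "f differentiable (at x)" using f[of x] by (auto simp: real_differentiable_def)
    then show "deriv0 f x = f' x" using DERIV_imp_deriv[OF f[of x]] by (simp add: deriv0_def)
  qed
  show "bounded (range (deriv0 f))"
    unfolding eq bounded_iff using C by auto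
qed

section \<open>A differential equation for the characteristic function\<close>

lemma integral_has_field_derivative:
  fixes h h' :: "real \<Rightarrow> 'a \<Rightarrow> real"
  assumes deriv: "\<And>t x. ((\<lambda>t. h t x) has_field_derivative h' t x) (at t)"
    and bound: "\<And>t x. \<bar>h' t x\<bar> \<le> w x" and w: "integrable M w"
    and h: "\<And>t. integrable M (h t)" and h': "h' t \<in> borel_measurable M"
  shows "((\<lambda>t. \<integral>x. h t x \<partial>M) has_field_derivative (\<integral>x. h' t x \<partial>M)) (at t)"
  unfolding has_field_derivative_iff tendsto_at_iff_sequentially o_def
proof (intro allI impI)
  fix y :: "nat \<Rightarrow> real"
  assume y: "\<forall>i. y i \<in> UNIV - {t}" "y \<longlonglongrightarrow> t"
  have ne: "y i \<noteq> t" for i using y(1) by auto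
  have "(\<lambda>i. \<integral>x. (h (y i) x - h t x) / (y i - t) \<partial>M) \<longlonglongrightarrow> (\<integral>x. h' t x \<partial>M)"
  proof (rule integral_dominated_convergence[OF h' _ w])
    show "(\<lambda>x. (h (y i) x - h t x) / (y i - t)) \<in> borel_measurable M" for i
      using h by (intro borel_measurable_divide borel_measurable_diff) auto
    have "(\<lambda>i. (h (y i) x - h t x) / (y i - t)) \<longlonglongrightarrow> h' t x" for x
      using deriv[of x t] y unfolding has_field_derivative_iff tendsto_at_iff_sequentially o_def by blast
    then show "AE x in M. (\<lambda>i. (h (y i) x - h t x) / (y i - t)) \<longlonglongrightarrow> h' t x" by simp
    have "norm (h (y i) x - h t x) \<le> w x * norm (y i - t)" for i x
      by (rule field_differentiable_bound[of UNIV _ "\<lambda>t. h' t x"]) (use deriv bound in auto)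
    then have "norm ((h (y i) x - h t x) / (y i - t)) \<le> w x" for i x
      using ne by (simp add: field_simps)
    then show "AE x in M. norm ((h (y i) x - h t x) / (y i - t)) \<le> w x" for i by simp
  qed
  then show "(\<lambda>i. ((\<integral>x. h (y i) x \<partial>M) - (\<integral>x. h t x \<partial>M)) / (y i - t)) \<longlonglongrightarrow> (\<integral>x. h' t x \<partial>M)"
    using h by simp
qed

context real_distribution
begin

lemma integrable_trig:
  "integrable M (\<lambda>x. cos (t * x))" "integrable M (\<lambda>x. sin (t * x))"
  by (rule integrable_const_bound[where B = 1]; simp)+

lemma char_trig: "char M t = Complex (\<integral>x. cos (t * x) \<partial>M) (\<integral>x. sin (t * x) \<partial>M)"
proof -
  have i: "integrable M (\<lambda>x. iexp (t * x))" by (rule integrable_iexp) (simp_all del: of_real_mult)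
  show ?thesis
    unfolding char_def complex_eq_iff
    using integral_Re[OF i] integral_Im[OF i] by (simp add: Re_exp Im_exp)
qed

lemma trig_integral_derivs:
  assumes "integrable M (\<lambda>x. x)"
  shows "((\<lambda>t. \<integral>x. cos (t * x) \<partial>M) has_field_derivative - (\<integral>x. x * sin (t * x) \<partial>M)) (at t)"
    and "((\<lambda>t. \<integral>x. sin (t * x) \<partial>M) has_field_derivative (\<integral>x. x * cos (t * x) \<partial>M)) (at t)"
proof -
  have w: "integrable M (\<lambda>x. \<bar>x\<bar>)" using assms by simp
  have le: "\<bar>x\<bar> * \<bar>s\<bar> \<le> \<bar>x\<bar>" if "\<bar>s\<bar> \<le> 1" for x s :: real
    using that by (intro mult_left_le) auto
  have "((\<lambda>t. \<integral>x. cos (t * x) \<partial>M) has_field_derivative (\<integral>x. - (x * sin (t * x)) \<partial>M)) (at t)"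
    by (rule integral_has_field_derivative[OF _ _ w])
      (auto intro!: derivative_eq_intros integrable_trig le simp: abs_mult)
  then show "((\<lambda>t. \<integral>x. cos (t * x) \<partial>M) has_field_derivative - (\<integral>x. x * sin (t * x) \<partial>M)) (at t)" by simp
  show "((\<lambda>t. \<integral>x. sin (t * x) \<partial>M) has_field_derivative (\<integral>x. x * cos (t * x) \<partial>M)) (at t)"
    by (rule integral_has_field_derivative[OF _ _ w])
      (auto intro!: derivative_eq_intros integrable_trig le simp: abs_mult)
qed

text \<open>
  The hypotheses say that the cosine and the sine transform of \<open>M\<close> both solve \<open>u' t = - t * u t\<close>,
  whose solutions are the multiples of \<open>exp (- t\<^sup>2 / 2)\<close>. The initial values are 1 and 0.
\<close>

theorem std_normal_if_trig_stein:
  assumes int: "integrable M (\<lambda>x. x)"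
    and "\<And>t. (\<integral>x. x * sin (t * x) \<partial>M) = t * (\<integral>x. cos (t * x) \<partial>M)"
    and "\<And>t. (\<integral>x. x * cos (t * x) \<partial>M) = - t * (\<integral>x. sin (t * x) \<partial>M)"
  shows "M = std_normal_distribution"
proof -
  have solve: "u t = u 0 * exp (- (t\<^sup>2) / 2)"
    if u: "\<And>t. (u has_field_derivative - t * u t) (at t)" for u :: "real \<Rightarrow> real" and t
  proof -
    \<comment> \<open>With the integrating factor exp (t^2 / 2) the solution becomes constant.\<close>
    have "((\<lambda>t. exp (t\<^sup>2 / 2)) has_field_derivative t * exp (t\<^sup>2 / 2)) (at t)" for t :: real
      by (auto intro!: derivative_eq_intros)
    from DERIV_mult[OF u this]
    have "((\<lambda>t. u t * exp (t\<^sup>2 / 2)) has_field_derivative 0) (at t)" for t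
      by (simp add: algebra_simps)
    then have "u t * exp (t\<^sup>2 / 2) = u 0 * exp (0\<^sup>2 / 2)"
      by (intro DERIV_isconst_all) auto
    then show ?thesis by (simp add: exp_minus field_simps)
  qed
  note d = trig_integral_derivs[OF int, unfolded assms(2,3)]
  have "(\<integral>x. cos (t * x) \<partial>M) = exp (- (t\<^sup>2) / 2)" for t
    using solve[of "\<lambda>t. \<integral>x. cos (t * x) \<partial>M" t] d(1) prob_space by simp
  moreover have "(\<integral>x. sin (t * x) \<partial>M) = 0" for t
    using solve[of "\<lambda>t. \<integral>x. sin (t * x) \<partial>M" t] d(2) by simp
  ultimately have "char M = char std_normal_distribution"
    by (auto simp: char_std_normal_distribution char_trig complex_eq_iff)
  then show ?thesis
    by (rule Levy_uniqueness[OF real_distribution_axioms real_dist_normal_dist])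
qed

end

section \<open>The square bias and the uniform distribution\<close>

abbreviation (input) uniform_sym :: "real measure" where
  "uniform_sym \<equiv> uniform_measure lborel {-1<..<1}"

lemma uniform_sym_density: "uniform_sym = density lborel (\<lambda>x. ennreal (indicator {-1<..<1} x / 2))"
proof -
  have "indicator {-1<..<1} x / emeasure lborel {-1<..<1::real} = ennreal (indicator {-1<..<1} x / 2)" for x :: real
    using divide_ennreal[of 1 2] by (simp add: indicator_def)
  then show ?thesis unfolding uniform_measure_def by simp
qed

lemma prob_space_uniform_sym: "prob_space uniform_sym"
  by (rule prob_space_uniform_measure) auto

lemma uniform_sym_integral:
  fixes f F :: "real \<Rightarrow> real"
  assumes F: "\<And>x. (F has_field_derivative f x) (at x)" and f: "\<And>x. isCont f x"
  shows "(\<integral>x. f x \<partial>uniform_sym) = (F 1 - F (- 1)) / 2"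
proof -
  have [measurable]: "f \<in> borel_measurable borel"
    using f by (intro borel_measurable_continuous_onI continuous_at_imp_continuous_on) auto
  have "(\<integral>x. f x \<partial>uniform_sym) = (\<integral>x. (indicator {-1<..<1} x / 2) *\<^sub>R f x \<partial>lborel)"
    unfolding uniform_sym_density by (rule integral_density) auto
  also have "\<dots> = (\<integral>x. f x * indicator {-1..1} x / 2 \<partial>lborel)"
  proof (rule integral_cong_AE)
    have "AE x in lborel. x \<noteq> 1 \<and> x \<noteq> (-1::real)"
      using AE_lborel_singleton[of "1::real"] AE_lborel_singleton[of "-1::real"] by eventually_elim simp
    then show "AE x in lborel. (indicator {-1<..<1} x / 2) *\<^sub>R f x = f x * indicator {-1..1} x / 2"
      by eventually_elim (auto simp: indicator_def)
  qed measurable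
  also have "\<dots> = (\<integral>x. f x * indicator {-1..1} x \<partial>lborel) / 2" by simp
  also have "(\<integral>x. f x * indicator {-1..1} x \<partial>lborel) = F 1 - F (- 1)"
    by (rule integral_FTC_Icc_real) (use F f in auto)
  finally show ?thesis .
qed

lemma uniform_sym_cos: "(\<integral>v. cos (a * v) \<partial>uniform_sym) = (if a = 0 then 1 else sin a / a)"
proof (cases "a = 0")
  case True
  interpret prob_space uniform_sym by (rule prob_space_uniform_sym)
  show ?thesis using True prob_space by simp
next
  case False
  have "(\<integral>v. cos (a * v) \<partial>uniform_sym) = (sin (a * 1) / a - sin (a * - 1) / a) / 2"
    by (rule uniform_sym_integral) (use False in \<open>auto intro!: derivative_eq_intros continuous_intros\<close>)
  with False show ?thesis by simp
qed

lemma uniform_sym_sin: "(\<integral>v. sin (a * v) \<partial>uniform_sym) = 0"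
proof (cases "a = 0")
  case False
  have "(\<integral>v. sin (a * v) \<partial>uniform_sym) = (- cos (a * 1) / a - - cos (a * - 1) / a) / 2"
    by (rule uniform_sym_integral) (use False in \<open>auto intro!: derivative_eq_intros continuous_intros\<close>)
  then show ?thesis by simp
qed simp

lemma power_bias_2:
  assumes "(\<integral>x. x\<^sup>2 \<partial>\<mu>) = 1"
  shows "power_bias 2 \<mu> = density \<mu> (\<lambda>x. ennreal (x\<^sup>2))"
  unfolding power_bias_def using assms by (simp add: powr_numeral)

lemma (in real_distribution) prob_space_power_bias_2:
  assumes "integrable M (\<lambda>x. x\<^sup>2)" "(\<integral>x. x\<^sup>2 \<partial>M) = 1"
  shows "prob_space (power_bias 2 M)"
proof (rule prob_spaceI)
  have "emeasure (power_bias 2 M) (space (power_bias 2 M)) = (\<integral>\<^sup>+x. ennreal (x\<^sup>2) \<partial>M)"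
    using assms(2) by (simp add: power_bias_2 emeasure_density space_density cong: nn_integral_cong)
  also have "\<dots> = 1" using nn_integral_eq_integral[OF assms(1)] assms(2) by simp
  finally show "emeasure (power_bias 2 M) (space (power_bias 2 M)) = 1" .
qed

text \<open>
  Fubini's theorem for a bounded function of two independent variables, averaging over \<open>X\<close> first.
\<close>

lemma (in prob_space) integral_indep_var:
  fixes g :: "real \<times> real \<Rightarrow> real"
  assumes indep: "indep_var borel X borel Y" and g: "g \<in> borel_measurable (borel \<Otimes>\<^sub>M borel)" "\<And>z. \<bar>g z\<bar> \<le> C"
  shows "(\<integral>\<omega>. g (X \<omega>, Y \<omega>) \<partial>M) = (\<integral>y. (\<integral>x. g (x, y) \<partial>distr M borel X) \<partial>distr M borel Y)"
proof -
  have XY [measurable]: "X \<in> borel_measurable M" "Y \<in> borel_measurable M"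
    and eq: "distr M borel X \<Otimes>\<^sub>M distr M borel Y = distr M (borel \<Otimes>\<^sub>M borel) (\<lambda>x. (X x, Y x))"
    using indep unfolding indep_var_distribution_eq by auto
  interpret X: prob_space "distr M borel X" by (rule prob_space_distr) simp
  interpret Y: prob_space "distr M borel Y" by (rule prob_space_distr) simp
  interpret XY: pair_prob_space "distr M borel X" "distr M borel Y" ..
  have g': "g \<in> borel_measurable (distr M borel X \<Otimes>\<^sub>M distr M borel Y)"
    using g(1) by (simp cong: measurable_cong_sets sets_pair_measure_cong)
  have "integrable (distr M borel X \<Otimes>\<^sub>M distr M borel Y) g"
    by (rule XY.integrable_const_bound[of _ C]) (use g(2) g' in auto)
  then have "(\<integral>y. (\<integral>x. g (x, y) \<partial>distr M borel X) \<partial>distr M borel Y) =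
      (\<integral>z. g z \<partial>(distr M borel X \<Otimes>\<^sub>M distr M borel Y))"
    using XY.integral_snd[of "\<lambda>x y. g (x, y)"] by simp
  also have "\<dots> = (\<integral>\<omega>. g (X \<omega>, Y \<omega>) \<partial>M)"
    unfolding eq using g(1) by (subst integral_distr) auto
  finally show ?thesis by simp
qed

text \<open>
  For fixed \<open>w\<close> the average of \<open>cos (t * v * w)\<close> over \<open>v\<close> is \<open>sin (t * w) / (t * w)\<close>. The bias
  multiplies it by \<open>w\<^sup>2\<close>, which leaves \<open>w * sin (t * w) / t\<close>, also for \<open>w = 0\<close>, where both sides vanish. The sine is odd in \<open>v\<close> and
  averages to zero. The factor \<open>t\<close> is kept on the left so that \<open>t = 0\<close> is included.
\<close>

lemma (in real_distribution) uniform_times_bias_trig: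
  assumes M2: "(\<integral>x. x\<^sup>2 \<partial>M) = 1"
    and N: "prob_space N" "prob_space.indep_var N borel V borel W2"
    and laws: "distr N borel V = uniform_sym" "distr N borel W2 = power_bias 2 M"
  shows "t * (\<integral>\<omega>. cos (t * (V \<omega> * W2 \<omega>)) \<partial>N) = (\<integral>x. x * sin (t * x) \<partial>M)"
    and "(\<integral>\<omega>. sin (t * (V \<omega> * W2 \<omega>)) \<partial>N) = 0"
proof -
  interpret N: prob_space N by (rule N)
  show "(\<integral>\<omega>. sin (t * (V \<omega> * W2 \<omega>)) \<partial>N) = 0"
    using N.integral_indep_var[OF N(2), of "\<lambda>(v, w). sin (t * (v * w))" 1] uniform_sym_sin[of "t * w" for w]
    by (simp add: laws split_beta mult.assoc mult.commute mult.left_commute)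
  show "t * (\<integral>\<omega>. cos (t * (V \<omega> * W2 \<omega>)) \<partial>N) = (\<integral>x. x * sin (t * x) \<partial>M)"
  proof (cases "t = 0")
    case False
    let ?s = "\<lambda>w. if t * w = 0 then 1 else sin (t * w) / (t * w)"
    have "(\<integral>\<omega>. cos (t * (V \<omega> * W2 \<omega>)) \<partial>N) = (\<integral>w. (\<integral>v. cos (t * (v * w)) \<partial>uniform_sym) \<partial>power_bias 2 M)"
      using N.integral_indep_var[OF N(2), of "\<lambda>(v, w). cos (t * (v * w))" 1]
      by (simp add: laws split_beta)
    also have "\<dots> = (\<integral>w. ?s w \<partial>power_bias 2 M)"
      using uniform_sym_cos[of "t * w" for w] by (simp add: mult.assoc mult.commute mult.left_commute)
    also have "\<dots> = (\<integral>w. w\<^sup>2 *\<^sub>R ?s w \<partial>M)"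
      unfolding power_bias_2[OF M2] by (rule integral_density) auto
    also have "\<dots> = (\<integral>w. w * sin (t * w) / t \<partial>M)"
      using False by (intro Bochner_Integration.integral_cong) (auto simp: power2_eq_square)
    finally show ?thesis using False by simp
  qed simp
qed

section \<open>The equivalence of normality, Stein's equation and the bias equation\<close>

theorem theorem1p6:
  fixes M :: "'a measure" and W :: "'a \<Rightarrow> real"
  assumes "prob_space M"
    and "W \<in> borel_measurable M"
    and "integrable M (\<lambda>\<omega>. (W \<omega>)\<^sup>2)"
  defines "normal \<equiv> distributed M lborel W std_normal_density"
    and "stein \<equiv> (\<forall>f. abs_continuous f \<and> bounded (range (deriv0 f)) \<longrightarrow>
           (\<integral>\<omega>. deriv0 f (W \<omega>) \<partial>M) = (\<integral>\<omega>. W \<omega> * f (W \<omega>) \<partial>M))"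
    and "bias \<equiv> (\<integral>\<omega>. (W \<omega>)\<^sup>2 \<partial>M) = 1 \<and>
           (\<exists>(N :: (real \<times> real) measure) V W2.
              prob_space N \<and>
              prob_space.indep_var N borel V borel W2 \<and>
              distr N borel V = uniform_measure lborel {-1<..<1} \<and>
              distr N borel W2 = power_bias 2 (distr M borel W) \<and>
              distr M borel W = distr N borel (\<lambda>\<omega>. V \<omega> * W2 \<omega>))"
  shows "(normal \<longleftrightarrow> stein) \<and> (stein \<longleftrightarrow> bias)"
proof -
  interpret prob_space M by fact
  define \<mu> where "\<mu> = distr M borel W"
  have W [measurable]: "W \<in> borel_measurable M" by fact
  interpret \<mu>: real_distribution \<mu> unfolding \<mu>_def by (rule real_distribution_distr[OF W])
  have law: "(\<integral>\<omega>. h (W \<omega>) \<partial>M) = (\<integral>x. h x \<partial>\<mu>)" if "h \<in> borel_measurable borel" for h :: "real \<Rightarrow> real"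
    unfolding \<mu>_def using that by (subst integral_distr) auto
  have int2: "integrable \<mu> (\<lambda>x. x\<^sup>2)"
    unfolding \<mu>_def using assms(3) by (subst integrable_distr_eq) auto
  have int1: "integrable \<mu> (\<lambda>x. x)"
  proof (rule Bochner_Integration.integrable_bound)
    show "integrable \<mu> (\<lambda>x. 1 + x\<^sup>2)" using int2 by simp
    have "\<bar>x\<bar> \<le> 1 + x\<^sup>2" for x :: real
      using sum_squares_bound[of 1 "\<bar>x\<bar>"] by simp
    then show "AE x in \<mu>. norm x \<le> norm (1 + x\<^sup>2)" by simp
  qed simp
  have normal_iff: "normal \<longleftrightarrow> \<mu> = std_normal_distribution"
    unfolding normal_def distributed_def \<mu>_def using W by (simp cong: distr_cong)
  have normal_imp_stein: stein if "\<mu> = std_normal_distribution"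
    unfolding stein_def
  proof (intro allI impI, elim conjE)
    fix f assume f: "abs_continuous f" "bounded (range (deriv0 f))"
    obtain C where C: "\<And>x. \<bar>deriv0 f x\<bar> \<le> C" using f(2) by (auto simp: bounded_iff)
    have cont: "continuous_on UNIV f"
      using abs_continuous_bounded_deriv_lipschitz[OF f(1) C] by (rule continuous_on_if_lipschitz)
    have meas [measurable]: "f \<in> borel_measurable borel" using cont by (rule borel_measurable_continuous_onI)
    have "(\<integral>\<omega>. deriv0 f (W \<omega>) \<partial>M) = (\<integral>x. deriv0 f x \<partial>\<mu>)"
      by (rule law) (rule borel_measurable_deriv0[OF cont])
    also have "\<dots> = (\<integral>x. x * f x \<partial>\<mu>)"
      unfolding that by (rule std_normal_stein_identity[OF f(1) C])
    also have "\<dots> = (\<integral>\<omega>. W \<omega> * f (W \<omega>) \<partial>M)" by (rule law[symmetric]) measurable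
    finally show "(\<integral>\<omega>. deriv0 f (W \<omega>) \<partial>M) = (\<integral>\<omega>. W \<omega> * f (W \<omega>) \<partial>M)" .
  qed
  have stein_trig: "(\<integral>x. x * sin (t * x) \<partial>\<mu>) = t * (\<integral>x. cos (t * x) \<partial>\<mu>)"
    "(\<integral>x. x * cos (t * x) \<partial>\<mu>) = - t * (\<integral>x. sin (t * x) \<partial>\<mu>)" if st: stein for t
  proof -
    have test: "(\<integral>\<omega>. deriv0 f (W \<omega>) \<partial>M) = (\<integral>\<omega>. W \<omega> * f (W \<omega>) \<partial>M)"
      if "abs_continuous f" "bounded (range (deriv0 f))" for f
      using st[unfolded stein_def, THEN spec, THEN mp, OF conjI, OF that] .
    have le: "\<bar>t\<bar> * \<bar>s\<bar> \<le> \<bar>t\<bar>" if "\<bar>s\<bar> \<le> 1" for s :: real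
      using that by (intro mult_left_le) auto
    have "((\<lambda>x. sin (t * x)) has_field_derivative t * cos (t * x)) (at x)" for x
      by (auto intro!: derivative_eq_intros)
    note f = bounded_derivative_imp_stein_test_function[OF this, of "\<bar>t\<bar>", unfolded abs_mult, OF le[OF abs_cos_le_one]]
    have "(\<integral>\<omega>. t * cos (t * W \<omega>) \<partial>M) = (\<integral>\<omega>. W \<omega> * sin (t * W \<omega>) \<partial>M)"
      using test[OF f(1,3)] unfolding f(2) .
    then show "(\<integral>x. x * sin (t * x) \<partial>\<mu>) = t * (\<integral>x. cos (t * x) \<partial>\<mu>)"
      using law[of "\<lambda>x. cos (t * x)"] law[of "\<lambda>x. x * sin (t * x)"] by simp
    have "((\<lambda>x. cos (t * x)) has_field_derivative - t * sin (t * x)) (at x)" for x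
      by (auto intro!: derivative_eq_intros)
    note f = bounded_derivative_imp_stein_test_function[OF this, of "\<bar>t\<bar>", unfolded abs_mult abs_minus_cancel, OF le[OF abs_sin_le_one]]
    have "(\<integral>\<omega>. - t * sin (t * W \<omega>) \<partial>M) = (\<integral>\<omega>. W \<omega> * cos (t * W \<omega>) \<partial>M)"
      using test[OF f(1,3)] unfolding f(2) .
    then show "(\<integral>x. x * cos (t * x) \<partial>\<mu>) = - t * (\<integral>x. sin (t * x) \<partial>\<mu>)"
      using law[of "\<lambda>x. sin (t * x)"] law[of "\<lambda>x. x * cos (t * x)"] by simp
  qed
  have stein_imp_normal: "\<mu> = std_normal_distribution" if stein
    by (rule \<mu>.std_normal_if_trig_stein[OF int1 stein_trig[OF that]])
  \<comment> \<open>The required pair is realised by the two coordinates on a product space; the law of their product is found from its characteristic function.\<close>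
  have normal_imp_bias: bias if std: "\<mu> = std_normal_distribution"
  proof -
    have "(\<integral>x. x\<^sup>2 \<partial>std_normal_distribution) = (\<integral>x. std_normal_density x * x ^ (2 * 1) \<partial>lborel)"
      by (simp add: integral_density)
    also have "\<dots> = 1" unfolding integral_std_normal_moment_even by simp
    finally have M2: "(\<integral>x. x\<^sup>2 \<partial>\<mu>) = 1" unfolding std .
    define B where "B = power_bias 2 \<mu>"
    have sets_B [measurable_cong]: "sets B = sets borel" unfolding B_def power_bias_def by simp
    interpret U: prob_space uniform_sym by (rule prob_space_uniform_sym)
    interpret B: prob_space B unfolding B_def by (rule \<mu>.prob_space_power_bias_2[OF int2 M2])
    interpret N: pair_prob_space uniform_sym B ..
    define N where "N = uniform_sym \<Otimes>\<^sub>M B"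
    have sets_N [measurable_cong]: "sets N = sets (borel \<Otimes>\<^sub>M borel)"
      unfolding N_def by (intro sets_pair_measure_cong sets_B) simp
    have pN: "prob_space N" unfolding N_def by (rule N.prob_space_axioms)
    have V: "distr N borel fst = uniform_sym"
    proof -
      have "distr N borel fst = distr N uniform_sym fst" by (rule distr_cong) simp_all
      also have "\<dots> = uniform_sym" unfolding N_def by (rule B.distr_pair_fst)
      finally show ?thesis .
    qed
    have W2: "distr N borel snd = B"
    proof (rule measure_eqI)
      fix A assume "A \<in> sets (distr N borel snd)"
      then have A: "A \<in> sets borel" by simp
      have "emeasure (distr N borel snd) A = emeasure (uniform_sym \<Otimes>\<^sub>M B) (space uniform_sym \<times> A)"
        using A by (subst emeasure_distr) (auto simp: N_def space_pair_measure sets_eq_imp_space_eq[OF sets_B]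
            intro!: arg_cong2[where f = emeasure])
      also have "\<dots> = emeasure B A"
        using A sets_B U.emeasure_space_1 by (subst B.emeasure_pair_measure_Times) auto
      finally show "emeasure (distr N borel snd) A = emeasure B A" .
    qed (simp add: sets_B)
    have indep: "prob_space.indep_var N borel fst borel snd"
    proof (subst prob_space.indep_var_distribution_eq[OF pN], intro conjI)
      show "distr N borel fst \<Otimes>\<^sub>M distr N borel snd = distr N (borel \<Otimes>\<^sub>M borel) (\<lambda>x. (fst x, snd x))"
        unfolding V W2 using distr_id2[OF sets_N[symmetric]] by (simp add: N_def)
    qed measurable
    define \<nu> where "\<nu> = distr N borel (\<lambda>z. fst z * snd z)"
    have prod [measurable]: "(\<lambda>z. fst z * snd z) \<in> borel_measurable N" by measurable
    interpret \<nu>: real_distribution \<nu>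
      unfolding \<nu>_def by (rule prob_space.real_distribution_distr[OF pN prod])
    note trig = \<mu>.uniform_times_bias_trig[OF M2 pN indep V W2[unfolded B_def]]
    have "char \<mu> t = char \<nu> t" for t
    proof (cases "t = 0")
      case False
      have "t * (\<integral>x. cos (t * x) \<partial>\<nu>) = t * (\<integral>x. cos (t * x) \<partial>\<mu>)"
        using trig(1)[of t] stein_trig(1)[OF normal_imp_stein[OF std], of t]
        unfolding \<nu>_def by (subst integral_distr) auto
      moreover have "(\<integral>x. sin (t * x) \<partial>\<nu>) = 0"
        using trig(2)[of t] unfolding \<nu>_def by (subst integral_distr) auto
      moreover have "(\<integral>x. sin (t * x) \<partial>\<mu>) = Im (char \<mu> t)" by (simp add: \<mu>.char_trig)
      then have "(\<integral>x. sin (t * x) \<partial>\<mu>) = 0" by (simp add: std char_std_normal_distribution)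
      ultimately show ?thesis using False by (simp add: \<mu>.char_trig \<nu>.char_trig)
    qed (simp add: \<mu>.char_zero \<nu>.char_zero)
    then have "\<mu> = \<nu>"
      by (intro Levy_uniqueness \<mu>.real_distribution_axioms \<nu>.real_distribution_axioms ext)
    moreover have "(\<integral>\<omega>. (W \<omega>)\<^sup>2 \<partial>M) = 1" using law[of "\<lambda>x. x\<^sup>2"] M2 by simp
    ultimately show bias
      unfolding bias_def using pN indep V W2 by (auto simp: \<mu>_def \<nu>_def B_def)
  qed
  have bias_imp_normal: "\<mu> = std_normal_distribution" if bias
  proof -
    have M2: "(\<integral>x. x\<^sup>2 \<partial>\<mu>) = 1" using \<open>bias\<close> law[of "\<lambda>x. x\<^sup>2"] unfolding bias_def by simp
    obtain N :: "(real \<times> real) measure" and V W2 where N: "prob_space N"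
      "prob_space.indep_var N borel V borel W2" "distr N borel V = uniform_sym"
      "distr N borel W2 = power_bias 2 \<mu>" and eq: "\<mu> = distr N borel (\<lambda>\<omega>. V \<omega> * W2 \<omega>)"
      using \<open>bias\<close> unfolding bias_def \<mu>_def by blast
    have [measurable]: "V \<in> borel_measurable N" "W2 \<in> borel_measurable N"
      using N(2) unfolding prob_space.indep_var_distribution_eq[OF N(1)] by auto
    have law': "(\<integral>x. h x \<partial>\<mu>) = (\<integral>\<omega>. h (V \<omega> * W2 \<omega>) \<partial>N)"
      if "h \<in> borel_measurable borel" for h :: "real \<Rightarrow> real"
      using that by (subst eq, subst integral_distr) auto
    note trig = \<mu>.uniform_times_bias_trig[OF M2 N]
    have sin0: "(\<integral>x. sin (t * x) \<partial>\<mu>) = 0" for t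
      using trig(2)[of t] law'[of "\<lambda>x. sin (t * x)"] by simp
    \<comment> \<open>The missing half of the differential equation: the sine transform vanishes identically, hence so does its derivative.\<close>
    have "((\<lambda>t. 0) has_field_derivative (\<integral>x. x * cos (t * x) \<partial>\<mu>)) (at t)" for t
      using \<mu>.trig_integral_derivs(2)[OF int1, of t] unfolding sin0 .
    then have "(\<integral>x. x * cos (t * x) \<partial>\<mu>) = 0" for t by (rule DERIV_unique) simp
    moreover have "(\<integral>x. x * sin (t * x) \<partial>\<mu>) = t * (\<integral>x. cos (t * x) \<partial>\<mu>)" for t
      using trig(1)[of t] law'[of "\<lambda>x. cos (t * x)"] by simp
    ultimately show ?thesis
      by (intro \<mu>.std_normal_if_trig_stein int1) (simp_all add: sin0)
  qed
  show ?thesis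
    using normal_iff normal_imp_stein stein_imp_normal normal_imp_bias bias_imp_normal by blast
qed

end
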